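(* Let $t\ge1$ be an integer and $g=2t+2$. Let $\omega\in\mathcal{DD}_{(g)}$ be a doubled distinct $g$-core, let $\mathbf{v}\in\mathbb{Z}^t$ be its $V_{g,t}$-coding, and set $r_i=v_i-g/2$ for $1\le i\le t$. Then $$|\omega| = \frac{1}{g}\sum_{i=1}^{t} r_i^2-\frac{(g/2-1)(g-1)}{12}.$$ Moreover, let $F$ be a field and $\tau:\mathbb{Z}\to F^{\times}$ any function. Setting $\alpha_i(\omega)=\#\{s\in\omega\mid h_s=g-i,\ \varepsilon_s=1\}$, $$\prod_{s\in\omega}\frac{\tau(h_s-\varepsilon_s g)}{\tau(h_s)}=\prod_{i=1}^{g-1}\left(\frac{\tau(-i)}{\tau(i)}\right)^{\alpha_i(\omega)}\prod_{i=1}^{t}\frac{\tau(r_i)}{\tau(i)}\prod_{1\le i<j\le t} \frac{\tau(r_i-r_j)}{\tau(j-i)}\, \frac{\tau(r_i+r_j)}{\tau(g-i-j)},$$ and, setting $\alpha'_i(\omega)=\#\{s\in\omega\mid h_s=g-i,\ \varepsilon_s=-1\}$, $$\prod_{s\in\omega}\frac{\tau(h_s+\varepsilon_s g)}{\tau(h_s)}=\prod_{i=1}^{g-1}\left(\frac{\tau(-i)}{\tau(i)}\right)^{\alpha'_i(\omega)}\prod_{i=1}^{t}\frac{\tau(2r_i)}{\tau(2i)}\,\frac{\tau(r_i)\,\tau(r_i+t+1)\,\tau(r_i-t-1)}{\tau(i)\,\tau(i+t+1)\,\tau(t+1-i)}\prod_{1\le i<j\le t} \frac{\tau(r_i-r_j)}{\tau(j-i)}\,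 \frac{\tau(r_i+r_j)}{\tau(g-i-j)}.$$
   Context: For a partition $\lambda$, $h_s$ is the hook length of a box $s$, $d_\lambda=\max\{s:\lambda_s\ge s\}$, and $\varepsilon_s=-1$ if $s$ is strictly below the main diagonal of the Ferrers diagram (English convention), $\varepsilon_s=1$ otherwise. A $g$-core is a partition with no hook length divisible by $g$. $\mathcal{DD}$ is the set of partitions with $\lambda_i=\lambda'_i+1$ for $1\le i\le d_\lambda$ ($\lambda'$ the conjugate; the empty partition included), and $\mathcal{DD}_{(g)}$ is the set of $g$-cores in $\mathcal{DD}$. Word of a partition: $\psi(\lambda)=(c_k)_{k\in\mathbb{Z}}\in\{0,1\}^{\mathbb{Z}}$ encodes the border of the Ferrers diagram read from South-West to North-East ($0$ vertical step, $1$ horizontal step), indexed so that $\#\{k\le -1: c_k=1\}=\#\{k\ge 0: c_k=0\}$; equivalently $c_k=0$ iff $k=\lambda_i-i$ for some $i\ge1$ (with $\lambda_i=0$ beyond the length). $V_{g,t}$-coding: for $i\in\{0,\dots,g-1\}$ let $\beta_i=\max\{(k+1)g+i\mid k\in\mathbb{Z},\ c_{kg+i}=0\}$; the $V_{g,t}$-coding is $\mathbf{v}=(v_1>\dots>v_t)$, the $t$ largest of the distinct integers $\beta_0,\dots,\beta_{g-1}$ in decreasing order.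
   Formalization: In the last identity τ(r_i−t−1) is replaced by τ(|r_i−t−1|); as printed it fails for t=1 and ω empty (r_1=1), where the left side is 1 and the right side is τ(−1)/τ(1). *)

theory Defs
  imports Complex_Main
begin

text \<open>
  A partition is the weakly decreasing list of its positive parts. Rows and columns of the
  Ferrers diagram (English convention) are numbered from 1.
\<close>

definition is_partition :: "nat list \<Rightarrow> bool" where
  "is_partition \<mu> \<longleftrightarrow> sorted_wrt (\<ge>) \<mu> \<and> 0 \<notin> set \<mu>"

text \<open>The \<open>i\<close>-th part, which is 0 beyond the length; the unused index 0 is sent to 0 as well.\<close>

definition part :: "nat list \<Rightarrow> nat \<Rightarrow> nat" where
  "part \<mu> i = (if 1 \<le> i \<and> i \<le> length \<mu> then \<mu> ! (i - 1) else 0)"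

definition conj_part :: "nat list \<Rightarrow> nat \<Rightarrow> nat" where
  "conj_part \<mu> j = card {i \<in> {1..length \<mu>}. j \<le> part \<mu> i}"

definition boxes :: "nat list \<Rightarrow> (nat \<times> nat) set" where
  "boxes \<mu> = {(i, j). 1 \<le> i \<and> i \<le> length \<mu> \<and> 1 \<le> j \<and> j \<le> part \<mu> i}"

text \<open>Arm plus leg plus one; the subtractions do not truncate for boxes of the diagram.\<close>

definition hook :: "nat list \<Rightarrow> nat \<times> nat \<Rightarrow> nat" where
  "hook \<mu> s = (part \<mu> (fst s) - snd s) + (conj_part \<mu> (snd s) - fst s) + 1"

definition eps :: "nat \<times> nat \<Rightarrow> int" where
  "eps s = (if fst s > snd s then - 1 else 1)"

text \<open>Since \<open>part \<mu> 0 = 0\<close>, the set always contains 0, and the empty partition gets the value 0.\<close>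

definition durfee :: "nat list \<Rightarrow> nat" where
  "durfee \<mu> = Max {s \<in> {0..length \<mu>}. s \<le> part \<mu> s}"

definition is_core :: "nat \<Rightarrow> nat list \<Rightarrow> bool" where
  "is_core g \<mu> \<longleftrightarrow> is_partition \<mu> \<and> (\<forall>s \<in> boxes \<mu>. \<not> g dvd hook \<mu> s)"

definition doubled_distinct :: "nat list set" where
  "doubled_distinct =
     {\<mu>. is_partition \<mu> \<and> (\<forall>i \<in> {1..durfee \<mu>}. part \<mu> i = conj_part \<mu> i + 1)}"

definition doubled_distinct_cores :: "nat \<Rightarrow> nat list set" where
  "doubled_distinct_cores g = {\<mu> \<in> doubled_distinct. is_core g \<mu>}"

text \<open>
  The bi-infinite border word read from South-West to North-East: the vertical step (letter 0)
  at the end of row \<open>i\<close> is the letter number \<open>\<mu>\<^sub>i - i\<close>, where also the empty rows beyond the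
  length count.
\<close>

definition word :: "nat list \<Rightarrow> int \<Rightarrow> nat" where
  "word \<mu> k = (if \<exists>i\<ge>1. k = int (part \<mu> i) - int i then 0 else 1)"

definition beta :: "nat \<Rightarrow> nat list \<Rightarrow> nat \<Rightarrow> int" where
  "beta g \<mu> i =
     (GREATEST b. \<exists>k::int. b = (k + 1) * int g + int i \<and> word \<mu> (k * int g + int i) = 0)"

definition V_coding :: "nat \<Rightarrow> nat \<Rightarrow> nat list \<Rightarrow> int list" where
  "V_coding g t \<mu> = take t (rev (sorted_list_of_set (beta g \<mu> ` {0..<g})))"

definition alpha :: "nat \<Rightarrow> nat list \<Rightarrow> nat \<Rightarrow> nat" where
  "alpha g \<mu> i = card {s \<in> boxes \<mu>. hook \<mu> s = g - i \<and> eps s = 1}"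

text \<open>
  The product of \<open>\<tau>(h + \<epsilon> g) / \<tau>(h)\<close> over the boxes evaluates \<open>\<tau>\<close> at a negative integer exactly
  at the boxes counted below. All the signs are thus absorbed by the powers of \<open>\<tau>(-i) / \<tau>(i)\<close>,
  and the other arguments have to be positive. This is why that identity is stated with
  \<open>\<tau>(\<bar>r\<^sub>i - t - 1\<bar>)\<close>: with \<open>\<tau>(r\<^sub>i - t - 1)\<close> it already fails for the empty partition and \<open>t = 1\<close>
  whenever \<open>\<tau>(-1) \<noteq> \<tau>(1)\<close>.
\<close>

definition alpha' :: "nat \<Rightarrow> nat list \<Rightarrow> nat \<Rightarrow> nat" where
  "alpha' g \<mu> i = card {s \<in> boxes \<mu>. hook \<mu> s = g - i \<and> eps s = - 1}"

end

theory Submission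
  imports Defs
begin

text \<open>
  Let \<open>X\<close> be the set of positions of the letter 0. Boxes are the pairs \<open>b < a\<close> with \<open>a \<in> X\<close> and
  \<open>b \<notin> X\<close>, with hook length \<open>a - b\<close>. For a doubled distinct partition \<open>0 \<notin> X\<close>, exactly one of
  \<open>k\<close>, \<open>- k\<close> lies in \<open>X\<close> for every \<open>k \<noteq> 0\<close>, and \<open>\<epsilon>\<close> is the sign of \<open>a + b\<close> (\<open>+ 1\<close> at 0). With
  \<open>T x = \<tau> \<bar>x\<bar>\<close> in place of \<open>\<tau>\<close>, which accounts for the powers of \<open>\<tau> (- i) / \<tau> i\<close>, all three
  identities follow by induction on the number of positive elements of \<open>X\<close>. Put \<open>h = g / 2\<close>.
  Exchanging the largest element \<open>a\<close> of \<open>X\<close> for \<open>- a\<close> gives a smaller core and replaces the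
  entry \<open>a + h\<close> of the coding by \<open>\<bar>a - h\<bar>\<close>. The factors lost by the product over the boxes
  telescope along the residue classes modulo \<open>g\<close>, and what remains are the factors
  \<open>T (a + h - \<rho>) / T (a - h - \<rho>)\<close>, one for each \<open>\<rho>\<close> in \<open>{0, - h} \<union> {\<plusminus> r\<^sub>1, \<dots>, \<plusminus> r\<^sub>t}\<close> other than \<open>a + h\<close>.
\<close>

subsection \<open>Symmetric Maya diagrams of doubled distinct cores\<close>

definition dd_core :: "int \<Rightarrow> int set \<Rightarrow> bool" where
  "dd_core h X \<longleftrightarrow> 0 < h \<and> 0 \<notin> X \<and> (\<forall>k. k \<noteq> 0 \<longrightarrow> (- k \<in> X \<longleftrightarrow> k \<notin> X)) \<and>
     (\<forall>x\<in>X. x - 2 * h \<in> X) \<and> finite {x \<in> X. 0 < x}"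

definition pos :: "int set \<Rightarrow> int set" where
  "pos X = {x \<in> X. 0 < x}"

text \<open>The \<open>\<beta>\<close>-numbers: the first missing position in each residue class modulo \<open>2 * h\<close>.\<close>

definition gaps :: "int \<Rightarrow> int set \<Rightarrow> int set" where
  "gaps h X = {b. b \<notin> X \<and> b - 2 * h \<in> X}"

definition coding :: "int \<Rightarrow> int set \<Rightarrow> int set" where
  "coding h X = {r. 0 < r \<and> r + h \<notin> X \<and> r - h \<in> X}"

definition flip :: "int \<Rightarrow> int set \<Rightarrow> int set" where
  "flip a X = insert (- a) (X - {a})"

definition inversions :: "int set \<Rightarrow> (int \<times> int) set" where
  "inversions X = {(a, b). a \<in> X \<and> b \<notin> X \<and> b < a}"

lemma dd_coreD:
  assumes "dd_core h X"
  shows "0 < h" "0 \<notin> X" "k \<noteq> 0 \<Longrightarrow> - k \<in> X \<longleftrightarrow> k \<notin> X" "x \<in> X \<Longrightarrow> x - 2 * h \<in> X" "finite (pos X)"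
  using assms unfolding dd_core_def pos_def by auto

lemma dd_core_half: "dd_core h X \<Longrightarrow> h \<notin> X \<and> - h \<in> X"
  using dd_coreD(1)[of h X] dd_coreD(3)[of h X h] dd_coreD(4)[of h X h] by auto

lemma dd_core_flip:
  assumes "dd_core h X" "a \<in> X" "0 < a" "\<And>x. x \<in> X \<Longrightarrow> x \<le> a"
  shows "dd_core h (flip a X)"
proof -
  note D = dd_coreD[OF assms(1)]
  have "x - 2 * h \<in> flip a X" if "x \<in> flip a X" for x
  proof (cases "x = - a")
    case True
    have "a + 2 * h \<notin> X" using assms(4)[of "a + 2 * h"] D(1) by auto
    then have "- (a + 2 * h) \<in> X" using D(1) D(3)[of "a + 2 * h"] assms(3) by auto
    moreover have "- (a + 2 * h) = x - 2 * h" using True by simp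
    ultimately show ?thesis using assms(3) D(1) by (auto simp: flip_def)
  next
    case False
    then have "x \<in> X" using that by (auto simp: flip_def)
    then have "x - 2 * h \<in> X" "x \<le> a" using D(4) assms(4) by auto
    then show ?thesis using D(1) by (auto simp: flip_def)
  qed
  moreover have "k \<noteq> 0 \<longrightarrow> (- k \<in> flip a X \<longleftrightarrow> k \<notin> flip a X)" for k
    using D(3)[of k] assms(2,3) by (auto simp: flip_def)
  moreover have "finite {x \<in> flip a X. 0 < x}"
    by (rule finite_subset[OF _ D(5)]) (use assms(3) in \<open>auto simp: flip_def pos_def\<close>)
  ultimately show ?thesis
    using D(1,2) assms(3) unfolding dd_core_def by (auto simp: flip_def)
qed

lemma pos_flip: "a \<in> X \<Longrightarrow> 0 < a \<Longrightarrow> pos X = insert a (pos (flip a X)) \<and> a \<notin> pos (flip a X)"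
  by (auto simp: pos_def flip_def)

lemma dd_core_induct [consumes 1, case_names empty flip]:
  assumes "dd_core h X"
    and base: "\<And>X. dd_core h X \<Longrightarrow> pos X = {} \<Longrightarrow> P X"
    and step: "\<And>X a. dd_core h X \<Longrightarrow> a \<in> X \<Longrightarrow> 0 < a \<Longrightarrow> (\<And>x. x \<in> X \<Longrightarrow> x \<le> a) \<Longrightarrow>
      dd_core h (flip a X) \<Longrightarrow> P (flip a X) \<Longrightarrow> P X"
  shows "P X"
  using assms(1)
proof (induction "card (pos X)" arbitrary: X)
  case 0
  then show ?case using base dd_coreD(5) by auto
next
  case (Suc n)
  have fin: "finite (pos X)" using Suc.prems by (rule dd_coreD)
  have ne: "pos X \<noteq> {}" using Suc.hyps(2) by auto
  define a where "a = Max (pos X)"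
  have a: "a \<in> X" "0 < a" using Max_in[OF fin ne] by (auto simp: a_def pos_def)
  have max: "x \<le> a" if "x \<in> X" for x
    using Max_ge[OF fin, of x] that a(2) by (cases "0 < x") (auto simp: a_def pos_def)
  have core: "dd_core h (flip a X)" using dd_core_flip[OF Suc.prems a max] .
  have "card (pos (flip a X)) = n"
    using pos_flip[OF a] Suc.hyps(2) dd_coreD(5)[OF core] by auto
  then show ?case using step[OF Suc.prems a max core] Suc.hyps(1) core by blast
qed

lemma dd_core_pos_empty:
  assumes "dd_core h X" "pos X = {}"
  shows "X = {..<0}"
proof -
  have "x \<in> X \<longleftrightarrow> x < 0" for x
    using dd_coreD(2)[OF assms(1)] dd_coreD(3)[OF assms(1), of x] assms(2)
    by (cases x "0 :: int" rule: linorder_cases) (auto simp: pos_def)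
  then show ?thesis by auto
qed

lemma coding_empty: "0 < h \<Longrightarrow> coding h {..<0} = {1..<h}"
  by (auto simp: coding_def)

lemma gaps_eq:
  assumes "dd_core h X"
  shows "gaps h X = {0, h} \<union> (\<lambda>r. h + r) ` coding h X \<union> (\<lambda>r. h - r) ` coding h X"
    (is "_ = ?B")
proof
  note D = dd_coreD[OF assms]
  have g: "2 * h \<notin> X" using D(2) D(4)[of "2 * h"] by auto
  then have "- (2 * h) \<in> X" using D(1) D(3)[of "2 * h"] by auto
  then have z: "0 \<in> gaps h X" using D(2) by (auto simp: gaps_def)
  show "gaps h X \<subseteq> ?B"
  proof
    fix b assume b: "b \<in> gaps h X"
    consider "b = 0 \<or> b = h" | "b > h" | "b \<noteq> 0" "b < h" by linarith
    then show "b \<in> ?B"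
    proof cases
      case 2
      then have "b - h \<in> coding h X" using b by (auto simp: gaps_def coding_def)
      then have "h + (b - h) \<in> ?B" by blast
      then show ?thesis by simp
    next
      case 3
      have "b \<noteq> 2 * h" using b D(2) by (auto simp: gaps_def)
      then have "- b \<in> X" "2 * h - b \<notin> X"
        using D(3)[of b] D(3)[of "2 * h - b"] 3 b by (auto simp: gaps_def)
      then have "h - b \<in> coding h X" using 3 by (auto simp: coding_def)
      then have "h - (h - b) \<in> ?B" by blast
      then show ?thesis by simp
    qed auto
  qed
  have "h - r \<in> gaps h X" if "r \<in> coding h X" for r
  proof -
    have r: "0 < r" "r + h \<notin> X" "r - h \<in> X" using that by (auto simp: coding_def)
    then have "r \<noteq> h" using D(2) by auto
    then have "h - r \<notin> X" "- (r + h) \<in> X"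
      using D(1) D(3)[of "r + h"] D(3)[of "h - r"] r by auto
    moreover have "- (r + h) = h - r - 2 * h" by simp
    ultimately show ?thesis by (metis (mono_tags, lifting) gaps_def mem_Collect_eq)
  qed
  moreover have "h + r \<in> gaps h X" if "r \<in> coding h X" for r
    using that by (auto simp: gaps_def coding_def algebra_simps)
  ultimately show "?B \<subseteq> gaps h X"
    using z dd_core_half[OF assms] by (auto simp: gaps_def)
qed

lemma half_notin_coding: "dd_core h X \<Longrightarrow> h \<notin> coding h X"
  using dd_coreD(2) by (auto simp: coding_def)

lemma finite_coding:
  assumes "dd_core h X"
  shows "finite (coding h X)"
proof (rule finite_subset)
  show "coding h X \<subseteq> {0..h} \<union> (\<lambda>x. x + h) ` pos X"
    unfolding coding_def pos_def image_def by force
  show "finite ({0..h} \<union> (\<lambda>x. x + h) ` pos X)" using dd_coreD(5)[OF assms] by simp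
qed

lemma coding_flip:
  assumes "dd_core h X" "a \<in> X" "0 < a" "\<And>x. x \<in> X \<Longrightarrow> x \<le> a"
  obtains R where "coding h X = insert (a + h) R" "a + h \<notin> R"
    "coding h (flip a X) = insert \<bar>a - h\<bar> R" "\<bar>a - h\<bar> \<notin> R" "finite R"
proof
  note D = dd_coreD[OF assms(1)]
  have ah: "a \<noteq> h" using dd_core_half[OF assms(1)] assms(2) by auto
  have a2: "a \<noteq> 2 * h" using D(4)[of a] D(2) assms(2) by auto
  have big: "a + 2 * h \<notin> X" using assms(4)[of "a + 2 * h"] D(1) by auto
  have low: "a - 2 * h \<in> X" "2 * h - a \<notin> X" using D(4) assms(2) D(3)[of "2 * h - a"] a2 by auto
  have ma: "- a \<notin> X" using D(3)[of a] assms(2,3) by auto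
  let ?R = "coding h X - {a + h}"
  show "coding h X = insert (a + h) ?R" using big assms(2,3) D(1) by (auto simp: coding_def add.commute)
  show "a + h \<notin> ?R" by simp
  show "finite ?R" using finite_coding[OF assms(1)] by simp
  show "\<bar>a - h\<bar> \<notin> ?R"
    using assms(2) ma by (auto simp: coding_def abs_if)
  have mem: "\<bar>a - h\<bar> \<in> coding h (flip a X)"
    using ah low assms(3) D(1) by (auto simp: coding_def flip_def abs_if)
  have "r \<in> coding h (flip a X) \<longleftrightarrow> r \<in> ?R" if "r \<noteq> \<bar>a - h\<bar>" for r
  proof (cases "0 < r")
    case True
    then have "r + h \<noteq> a" "r - h \<noteq> - a" "r + h \<noteq> - a"
      using that ah assms(3) D(1) by auto
    then show ?thesis using True by (auto simp: coding_def flip_def)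
  qed (simp add: coding_def)
  then show "coding h (flip a X) = insert \<bar>a - h\<bar> ?R"
    using mem by (intro set_eqI) (metis insert_iff)
qed

subsection \<open>Exchanging the largest element\<close>

lemma prod_div_exchange:
  fixes f :: "'b \<Rightarrow> 'a::field"
  assumes "finite A" "finite B" "\<And>x. f x \<noteq> 0"
  shows "prod f A / prod f B = prod f (A - B) / prod f (B - A)"
proof -
  have "prod f A = prod f (A \<inter> B) * prod f (A - B)" "prod f B = prod f (A \<inter> B) * prod f (B - A)"
    using prod.Int_Diff[OF assms(1), of f B] prod.Int_Diff[OF assms(2), of f A]
    by (simp_all add: Int_commute)
  moreover have "prod f (A \<inter> B) \<noteq> 0" using assms by (simp add: prod_zero_iff)
  ultimately show ?thesis by simp
qed

lemma prod_reflect_quotient: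
  fixes T :: "int \<Rightarrow> 'a::field"
  assumes "\<And>x. T x \<noteq> 0"
  shows "(\<Prod>y\<in>{1..<g}. T y / T (g - y)) = 1"
proof -
  have "(\<Prod>y\<in>{1..<g}. T (g - y)) = (\<Prod>y\<in>{1..<g}. T y)"
    by (rule prod.reindex_bij_witness[of _ "\<lambda>y. g - y" "\<lambda>y. g - y"]) auto
  then show ?thesis using assms by (simp add: prod_dividef prod_zero_iff)
qed

text \<open>
  The translates of \<open>{b. b \<notin> X \<and> b < a}\<close> by \<open>\<plusminus> g\<close> differ from the set itself only near \<open>a\<close> and
  at the first gaps. The part near \<open>a\<close> cancels because \<open>T (y - g) = T (g - y)\<close>.
\<close>

lemma prod_gaps_telescope:
  fixes T :: "int \<Rightarrow> 'a::field"
  assumes T: "\<And>x. T x \<noteq> 0" "\<And>x. T (- x) = T x"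
    and g: "0 < g" and closed: "\<And>x. x \<in> X \<Longrightarrow> x - g \<in> X"
    and a: "a \<in> X" "\<And>x. x \<in> X \<Longrightarrow> x \<le> a"
    and fin: "finite {b. b \<notin> X \<and> b < a}"
  shows "(\<Prod>b | b \<notin> X \<and> b < a. T (a - b - g) / T (a - b) * (T (a - b + g) / T (a - b)))
       = (\<Prod>b \<in> {b. b \<notin> X \<and> b - g \<in> X} - {a + g}. T (a - b + g) / T (a - b))"
proof -
  define f where "f b = T (a - b)" for b
  have f: "f b \<noteq> 0" for b using T by (simp add: f_def)
  define N where "N = {b. b \<notin> X \<and> b < a}"
  define L where "L = {b. b \<notin> X \<and> b < a \<and> b - g \<in> X}"
  define Y where "Y = {b. b \<notin> X \<and> a - g \<le> b \<and> b < a}"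
  define U where "U = {b. b \<notin> X \<and> b - g \<in> X \<and> a < b \<and> b \<noteq> a + g}"
  define V where "V = {1..<g} - {y. a - y \<in> X}"
  define W where "W = {1..<g} \<inter> {y. a - y \<in> X}"
  have N: "finite N" using fin by (simp add: N_def)
  have L: "finite L" by (rule finite_subset[OF _ N]) (auto simp: L_def N_def)
  have up: "b + g \<notin> X" if "b \<notin> X" for b using closed[of "b + g"] that by auto
  have ag: "a - g \<in> X" using closed a(1) .
  have "(\<Prod>b\<in>N. T (a - b + g)) = prod f ((\<lambda>b. b - g) ` N)"
    by (subst prod.reindex) (auto simp: inj_on_def f_def intro!: prod.cong arg_cong[of _ _ T])
  moreover have "(\<lambda>b. b - g) ` N - N = (\<lambda>b. b - g) ` L"
    unfolding N_def L_def using g by force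
  moreover have "N - (\<lambda>b. b - g) ` N = Y"
  proof -
    have "x \<in> (\<lambda>b. b - g) ` N \<longleftrightarrow> x + g \<in> N" for x
      by (metis (no_types, lifting) add_diff_cancel_right' diff_add_cancel image_iff)
    then show ?thesis using up by (auto simp: N_def Y_def)
  qed
  moreover have "prod f ((\<lambda>b. b - g) ` L) = (\<Prod>b\<in>L. T (a - b + g))"
    by (subst prod.reindex) (auto simp: inj_on_def f_def intro!: prod.cong arg_cong[of _ _ T])
  ultimately have 1: "(\<Prod>b\<in>N. T (a - b + g)) / prod f N = (\<Prod>b\<in>L. T (a - b + g)) / prod f Y"
    using prod_div_exchange[of "(\<lambda>b. b - g) ` N" N f] N f by simp
  have "(\<Prod>b\<in>N. T (a - b - g)) = prod f ((\<lambda>b. b + g) ` N)"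
    by (subst prod.reindex) (auto simp: inj_on_def f_def intro!: prod.cong arg_cong[of _ _ T])
  moreover have "(\<lambda>b. b + g) ` N - N = (\<lambda>b. b + g) ` Y"
  proof -
    have "x \<in> (\<lambda>b. b + g) ` M \<longleftrightarrow> x - g \<in> M" for x M
      by (metis (no_types, lifting) add_diff_cancel_right' diff_add_cancel image_iff)
    then show ?thesis using up[of "_ - g"] by (auto simp: N_def Y_def)
  qed
  moreover have "N - (\<lambda>b. b + g) ` N = L"
  proof -
    have "x \<in> (\<lambda>b. b + g) ` N \<longleftrightarrow> x - g \<in> N" for x
      by (metis (no_types, lifting) add_diff_cancel_right' diff_add_cancel image_iff)
    then show ?thesis using g by (auto simp: N_def L_def)
  qed
  moreover have "prod f ((\<lambda>b. b + g) ` Y) = (\<Prod>b\<in>Y. T (a - b - g))"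
    by (subst prod.reindex) (auto simp: inj_on_def f_def intro!: prod.cong arg_cong[of _ _ T])
  ultimately have 2: "(\<Prod>b\<in>N. T (a - b - g)) / prod f N = (\<Prod>b\<in>Y. T (a - b - g)) / prod f L"
    using prod_div_exchange[of "(\<lambda>b. b + g) ` N" N f] N f by simp
  have "(\<Prod>b\<in>N. T (a - b - g) / T (a - b) * (T (a - b + g) / T (a - b)))
      = ((\<Prod>b\<in>N. T (a - b - g)) / prod f N) * ((\<Prod>b\<in>N. T (a - b + g)) / prod f N)"
    by (simp add: prod.distrib prod_dividef f_def)
  also have "\<dots> = (\<Prod>b\<in>L. T (a - b + g) / T (a - b)) * (\<Prod>b\<in>Y. T (a - b - g) / T (a - b))"
    unfolding 1 2 by (simp add: prod_dividef f_def)
  also have "(\<Prod>b\<in>Y. T (a - b - g) / T (a - b)) = (\<Prod>y\<in>V. T (g - y) / T y)"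
  proof (rule prod.reindex_bij_witness[of _ "\<lambda>y. a - y" "\<lambda>b. a - b"])
    fix b assume b: "b \<in> Y"
    then have "b \<noteq> a - g" using ag by (auto simp: Y_def)
    then show "a - b \<in> V" using b by (auto simp: Y_def V_def)
    show "T (g - (a - b)) / T (a - b) = T (a - b - g) / T (a - b)"
      using T(2)[of "a - b - g"] by simp
  qed (auto simp: Y_def V_def)
  also have "\<dots> = (\<Prod>y\<in>W. T y / T (g - y))"
  proof -
    have "(\<Prod>y\<in>V. T y / T (g - y)) * (\<Prod>y\<in>W. T y / T (g - y)) = (\<Prod>y\<in>{1..<g}. T y / T (g - y))"
      unfolding V_def W_def
      by (subst prod.union_disjoint[symmetric]) (auto intro!: prod.cong finite_Collect_conjI)
    also have "\<dots> = 1" using T(1) by (rule prod_reflect_quotient)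
    finally have "(\<Prod>y\<in>W. T y / T (g - y)) = inverse (\<Prod>y\<in>V. T y / T (g - y))"
      by (metis inverse_unique)
    then show ?thesis by (simp add: prod_inversef[symmetric])
  qed
  also have "\<dots> = (\<Prod>b\<in>U. T (a - b + g) / T (a - b))"
  proof (rule prod.reindex_bij_witness[of _ "\<lambda>b. a - b + g" "\<lambda>y. a - y + g"])
    fix y assume y: "y \<in> W"
    then have "a < a - y + g" by (auto simp: W_def)
    then have "a - y + g \<notin> X" using a(2) by fastforce
    then show "a - y + g \<in> U" using y by (auto simp: W_def U_def)
    show "T (a - (a - y + g) + g) / T (a - (a - y + g)) = T y / T (g - y)"
      using T(2)[of "g - y"] by simp
  next
    fix b assume b: "b \<in> U"
    then have "b - g \<le> a" using a(2) by (auto simp: U_def)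
    then show "a - b + g \<in> W" using b by (auto simp: W_def U_def algebra_simps)
  qed auto
  also have "(\<Prod>b\<in>L. T (a - b + g) / T (a - b)) * (\<Prod>b\<in>U. T (a - b + g) / T (a - b))
     = (\<Prod>b\<in>L \<union> U. T (a - b + g) / T (a - b))"
  proof (rule prod.union_disjoint[symmetric])
    have "U \<subseteq> {a..a + g}" using a(2) by (force simp: U_def)
    then show "finite U" using finite_subset by blast
  qed (use L in \<open>auto simp: L_def U_def\<close>)
  also have "L \<union> U = {b. b \<notin> X \<and> b - g \<in> X} - {a + g}"
  proof (intro set_eqI)
    fix b
    have "b < a \<or> b = a \<or> a < b" by linarith
    then show "b \<in> L \<union> U \<longleftrightarrow> b \<in> {b. b \<notin> X \<and> b - g \<in> X} - {a + g}"
      using a(1) g by (auto simp: L_def U_def)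
  qed
  finally show ?thesis by (simp add: N_def)
qed

lemma inversions_prod:
  fixes f :: "int \<Rightarrow> int \<Rightarrow> 'a::comm_monoid_mult"
  assumes "dd_core h X"
  shows "(\<Prod>(a, b)\<in>inversions X. f (a - b) (if a + b \<ge> 0 then 1 else - 1))
       = (\<Prod>a\<in>pos X. f a 1 * f (2 * a) 1 *
            (\<Prod>b\<in>{- a<..<a} - X - {0}. f (a - b) 1 * f (a - b) (- 1)))"
proof -
  note D = dd_coreD[OF assms]
  let ?M = "\<lambda>a. {- a<..<a} - X - {0}"
  let ?F = "\<lambda>(a, b). f (a - b) (if a + b \<ge> 0 then 1 else - 1)"
  let ?P = "Sigma (pos X) (\<lambda>a. {- a..<a} - X)"
  let ?Q = "Sigma (pos X) ?M"
  let ?m = "\<lambda>(a, b). (- b, - a) :: int \<times> int"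
  have "inversions X = ?P \<union> ?m ` ?Q"
  proof (intro equalityI subsetI)
    fix p assume "p \<in> inversions X"
    then obtain a b where p: "p = (a, b)" "a \<in> X" "b \<notin> X" "b < a"
      by (auto simp: inversions_def)
    show "p \<in> ?P \<union> ?m ` ?Q"
    proof (cases "0 \<le> a + b")
      case True
      then show ?thesis using p by (auto simp: pos_def)
    next
      case False
      then have "b \<noteq> 0" "a \<noteq> 0" using p D(2) by auto
      then have "(- b, - a) \<in> ?Q" using p D(3)[of b] D(3)[of a] False by (auto simp: pos_def)
      then have "?m (- b, - a) \<in> ?m ` ?Q" by (rule imageI)
      then show ?thesis using p by simp
    qed
  next
    fix p assume "p \<in> ?P \<union> ?m ` ?Q"
    then show "p \<in> inversions X"
    proof
      assume "p \<in> ?m ` ?Q"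
      then obtain q where q: "q \<in> ?Q" "p = ?m q" by blast
      obtain a b where "q = (a, b)" "a \<in> pos X" "b \<in> ?M a" using q(1) by blast
      then have "p = (- b, - a)" "a \<in> pos X" "b \<in> ?M a" using q(2) by simp_all
      then show ?thesis using D(3)[of a] D(3)[of b] by (auto simp: inversions_def pos_def)
    qed (auto simp: inversions_def pos_def)
  qed
  moreover have "?P \<inter> ?m ` ?Q = {}" by auto
  moreover have "finite ?P" "finite ?Q" using D(5) by auto
  ultimately have "prod ?F (inversions X) = prod ?F ?P * prod ?F (?m ` ?Q)"
    by (simp add: prod.union_disjoint)
  also have "prod ?F ?P = (\<Prod>(a, b)\<in>?P. f (a - b) 1)"
    by (intro prod.cong) auto
  also have "\<dots> = (\<Prod>a\<in>pos X. \<Prod>b\<in>{- a..<a} - X. f (a - b) 1)"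
    using D(5) by (simp add: prod.Sigma)
  also have "\<dots> = (\<Prod>a\<in>pos X. f a 1 * f (2 * a) 1 * (\<Prod>b\<in>?M a. f (a - b) 1))"
  proof (rule prod.cong[OF refl])
    fix a assume a: "a \<in> pos X"
    then have "{- a..<a} - X = insert (- a) (insert 0 (?M a))"
      using D(2) D(3)[of a] by (auto simp: pos_def)
    moreover have "0 \<notin> ?M a" "- a \<notin> insert 0 (?M a)" "finite (?M a)"
      using a by (auto simp: pos_def)
    ultimately have "(\<Prod>b\<in>{- a..<a} - X. f (a - b) 1)
        = f (a - - a) 1 * (f (a - 0) 1 * (\<Prod>b\<in>?M a. f (a - b) 1))"
      by (simp only: prod.insert finite_insert simp_thms)
    then show "(\<Prod>b\<in>{- a..<a} - X. f (a - b) 1) = f a 1 * f (2 * a) 1 * (\<Prod>b\<in>?M a. f (a - b) 1)"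
      by (simp add: mult_ac)
  qed
  also have "prod ?F (?m ` ?Q) = (\<Prod>(a, b)\<in>?Q. f (a - b) (- 1))"
    by (subst prod.reindex) (auto simp: inj_on_def intro!: prod.cong)
  also have "\<dots> = (\<Prod>a\<in>pos X. \<Prod>b\<in>?M a. f (a - b) (- 1))"
    using D(5) by (simp add: prod.Sigma)
  finally show ?thesis by (simp add: prod.distrib mult_ac)
qed

lemma finite_noninversions:
  assumes "dd_core h X" "a \<in> X" "0 < a" "\<And>x. x \<in> X \<Longrightarrow> x \<le> a"
  shows "finite {b. b \<notin> X \<and> b < a}"
proof (rule finite_subset)
  show "{b. b \<notin> X \<and> b < a} \<subseteq> {- a..a}"
  proof
    fix b assume b: "b \<in> {b. b \<notin> X \<and> b < a}"
    then have "- b \<le> a" using dd_coreD(3)[OF assms(1), of b] assms(3,4) by (cases "b = 0") auto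
    then show "b \<in> {- a..a}" using b by auto
  qed
qed simp

lemma max_element_prod:
  fixes T :: "int \<Rightarrow> 'a::field"
  assumes core: "dd_core h X" and a: "a \<in> X" "0 < a" "\<And>x. x \<in> X \<Longrightarrow> x \<le> a"
    and T: "\<And>x. T x \<noteq> 0" "\<And>x. T (- x) = T x"
    and R: "coding h X = insert (a + h) R" "a + h \<notin> R" "finite R"
  shows "(\<Prod>b\<in>{- a<..<a} - X - {0}. T (a - b - 2 * h) / T (a - b) * (T (a - b + 2 * h) / T (a - b)))
    = T a / T (a - 2 * h) * (T (2 * a) / T (2 * a - 2 * h)) * (T (a + h) / T (a - h))
      * (\<Prod>s\<in>R. T (a + h - s) * T (a + h + s) / (T (a - h - s) * T (a - h + s)))"
    (is "prod ?q ?M = _ * ?Q")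
proof -
  note D = dd_coreD[OF core]
  let ?k = "\<lambda>b. T (a - b + 2 * h) / T (a - b)"
  have Rpos: "0 < s" "s \<noteq> h" if "s \<in> R" for s
    using that R(1) half_notin_coding[OF core] by (auto simp: coding_def)
  have "{b. b \<notin> X \<and> b < a} = insert (- a) (insert 0 ?M)"
  proof (intro set_eqI iffI)
    fix b assume b: "b \<in> {b. b \<notin> X \<and> b < a}"
    then have "b \<noteq> 0 \<Longrightarrow> - b \<le> a" using D(3)[of b] a(3) by auto
    then show "b \<in> insert (- a) (insert 0 ?M)" using b by auto
  qed (use a D(2) D(3)[of a] in auto)
  moreover have "0 \<notin> ?M" "- a \<notin> insert 0 ?M" "finite ?M" using a(2) by auto
  ultimately have "?q (- a) * (?q 0 * prod ?q ?M) = (\<Prod>b | b \<notin> X \<and> b < a. ?q b)"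
    by (simp only: prod.insert finite_insert simp_thms)
  also have "\<dots> = (\<Prod>b \<in> gaps h X - {a + 2 * h}. ?k b)"
    unfolding gaps_def using D(1,4) a finite_noninversions[OF core a] T
    by (intro prod_gaps_telescope) auto
  also have "gaps h X - {a + 2 * h}
      = insert 0 (insert h (insert (- a) ((\<lambda>s. h + s) ` R \<union> (\<lambda>s. h - s) ` R)))" (is "_ = ?B")
  proof -
    have "a + 2 * h \<notin> ?B"
    proof
      assume "a + 2 * h \<in> ?B"
      then consider s where "s \<in> R" "a + 2 * h = h + s" | s where "s \<in> R" "a + 2 * h = h - s"
        using a(2) D(1) by auto
      then show False
      proof cases
        case 1
        then have "s = a + h" by simp
        then show False using 1(1) R(2) by simp
      next
        case 2
        then show False using Rpos(1)[of s] a(2) D(1) by simp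
      qed
    qed
    moreover have "gaps h X = insert (a + 2 * h) ?B"
      unfolding gaps_eq[OF core] R(1) by auto
    ultimately show ?thesis by simp
  qed
  also have "prod ?k ?B = ?k 0 * (?k h * (?k (- a) *
      (prod ?k ((\<lambda>s. h + s) ` R) * prod ?k ((\<lambda>s. h - s) ` R))))"
  proof -
    have n: "- a \<notin> (\<lambda>s. h + s) ` R \<union> (\<lambda>s. h - s) ` R"
    proof
      assume "- a \<in> (\<lambda>s. h + s) ` R \<union> (\<lambda>s. h - s) ` R"
      then obtain s where s: "s \<in> R" "- a = h + s \<or> - a = h - s" by auto
      then have "s = a + h" using Rpos(1)[of s] a(2) D(1) by auto
      then show False using s(1) R(2) by simp
    qed
    have "h \<notin> insert (- a) ((\<lambda>s. h + s) ` R \<union> (\<lambda>s. h - s) ` R)"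
      using Rpos a(2) D(1) by force
    moreover have "0 \<notin> insert h (insert (- a) ((\<lambda>s. h + s) ` R \<union> (\<lambda>s. h - s) ` R))"
      using Rpos a(2) D(1) by force
    moreover have "(\<lambda>s. h + s) ` R \<inter> (\<lambda>s. h - s) ` R = {}"
      using Rpos(1) by (fastforce dest: Rpos(1))
    ultimately show ?thesis
      using n R(3) by (simp add: prod.union_disjoint)
  qed
  also have "prod ?k ((\<lambda>s. h + s) ` R) * prod ?k ((\<lambda>s. h - s) ` R) = ?Q"
    by (simp add: prod.reindex inj_on_def prod.distrib[symmetric] algebra_simps)
  finally have "?q (- a) * (?q 0 * prod ?q ?M) = ?k 0 * (?k h * (?k (- a) * ?Q))" .
  moreover have "P = A / B * (C / D) * (E / F) * Q"
    if "D / C * (G / C) * (B / A * (H / A) * P) = H / A * (E / F * (G / C * Q))"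
      "A \<noteq> 0" "B \<noteq> 0" "C \<noteq> 0" "D \<noteq> 0" "F \<noteq> 0" "G \<noteq> 0" "H \<noteq> 0"
    for A B C D E F G H P Q :: 'a
    using that by (simp add: field_simps)
  moreover have "a - - a = 2 * a" "a - h + 2 * h = a + h" by simp_all
  ultimately show ?thesis using T(1) by (metis (no_types, lifting) diff_0_right)
qed

definition pairs :: "int set \<Rightarrow> (int \<times> int) set" where
  "pairs R = {(r, s). r \<in> R \<and> s \<in> R \<and> s < r}"

lemma finite_pairs: "finite R \<Longrightarrow> finite (pairs R)"
  by (rule finite_subset[of _ "R \<times> R"]) (auto simp: pairs_def)

lemma prod_pairs_insert:
  fixes H :: "int \<Rightarrow> int \<Rightarrow> 'a::comm_monoid_mult"
  assumes "finite R" "x \<notin> R" "\<And>r s. H r s = H s r"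
  shows "(\<Prod>(r, s)\<in>pairs (insert x R). H r s) = (\<Prod>(r, s)\<in>pairs R. H r s) * (\<Prod>s\<in>R. H x s)"
proof -
  let ?A = "{s \<in> R. s < x}" and ?B = "{s \<in> R. x < s}"
  have "pairs (insert x R) = pairs R \<union> (Pair x ` ?A \<union> (\<lambda>s. (s, x)) ` ?B)"
    using assms(2) by (auto simp: pairs_def)
  then have "(\<Prod>(r, s)\<in>pairs (insert x R). H r s) = (\<Prod>(r, s)\<in>pairs R. H r s)
      * ((\<Prod>(r, s)\<in>Pair x ` ?A. H r s) * (\<Prod>(r, s)\<in>(\<lambda>s. (s, x)) ` ?B. H r s))"
    using assms(1,2) finite_pairs[OF assms(1)]
    by (subst prod.union_disjoint[symmetric], (auto simp: pairs_def)[3])+ simp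
  also have "(\<Prod>(r, s)\<in>Pair x ` ?A. H r s) = (\<Prod>s\<in>?A. H x s)"
    by (simp add: prod.reindex inj_on_def)
  also have "(\<Prod>(r, s)\<in>(\<lambda>s. (s, x)) ` ?B. H r s) = (\<Prod>s\<in>?B. H x s)"
    using assms(3) by (simp add: prod.reindex inj_on_def)
  also have "(\<Prod>s\<in>?A. H x s) * (\<Prod>s\<in>?B. H x s) = (\<Prod>s\<in>?A \<union> ?B. H x s)"
    using assms(1) by (subst prod.union_disjoint) auto
  also have "?A \<union> ?B = R" using assms(2) by (auto, metis linorder_cases)
  finally show ?thesis .
qed

definition coding_prod :: "(int \<Rightarrow> 'a::comm_monoid_mult) \<Rightarrow> (int \<Rightarrow> 'a) \<Rightarrow> int set \<Rightarrow> 'a" where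
  "coding_prod T w R = (\<Prod>r\<in>R. w r) * (\<Prod>(r, s)\<in>pairs R. T (r - s) * T (r + s))"

lemma coding_prod_insert:
  fixes T :: "int \<Rightarrow> 'a::field"
  assumes "finite R" "\<bar>x\<bar> \<notin> R" "\<And>x. T (- x) = T x" "\<And>x. w (- x) = w x"
  shows "coding_prod T w (insert \<bar>x\<bar> R)
    = coding_prod T w R * w x * (\<Prod>s\<in>R. T (x - s) * T (x + s))"
proof -
  have swap: "T (r - s) = T (s - r)" for r s using assms(3)[of "s - r"] by simp
  have "T (r - s) * T (r + s) = T (s - r) * T (s + r)" for r s
    using swap[of r s] by (simp add: add.commute)
  then have "(\<Prod>(r, s)\<in>pairs (insert \<bar>x\<bar> R). T (r - s) * T (r + s))
     = (\<Prod>(r, s)\<in>pairs R. T (r - s) * T (r + s)) * (\<Prod>s\<in>R. T (\<bar>x\<bar> - s) * T (\<bar>x\<bar> + s))"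
    by (rule prod_pairs_insert[OF assms(1,2)])
  moreover have "T (\<bar>x\<bar> - s) * T (\<bar>x\<bar> + s) = T (x - s) * T (x + s)" for s
    using assms(3)[of "- x - s"] assms(3)[of "- x + s"] by (auto simp: abs_if algebra_simps)
  moreover have "w \<bar>x\<bar> = w x" using assms(4) by (simp add: abs_if)
  ultimately show ?thesis
    using assms(1,2) by (simp add: coding_prod_def mult_ac)
qed

lemma dd_core_prod:
  fixes T w :: "int \<Rightarrow> 'a::field"
  assumes core: "dd_core h X"
    and T: "\<And>x. T x \<noteq> 0" "\<And>x. T (- x) = T x"
    and w: "\<And>x. w x \<noteq> 0" "\<And>x. w (- x) = w x"
    and weight: "\<And>a. w (a + h) / w (a - h) =
      T (a - e * (2 * h)) / T (a - 2 * h) * (T (2 * a - e * (2 * h)) / T (2 * a - 2 * h))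
      * (T (a + h) / T (a - h))"
  shows "(\<Prod>a\<in>pos X. T (a - e * (2 * h)) / T a * (T (2 * a - e * (2 * h)) / T (2 * a)) *
      (\<Prod>b\<in>{- a<..<a} - X - {0}. T (a - b - 2 * h) / T (a - b) * (T (a - b + 2 * h) / T (a - b))))
      * coding_prod T w {1..<h} = coding_prod T w (coding h X)"
    (is "(\<Prod>a\<in>pos X. ?G X a) * _ = _")
  using core
proof (induction rule: dd_core_induct)
  case (empty X)
  then show ?case using coding_empty dd_coreD(1) dd_core_pos_empty by fastforce
next
  case (flip X a)
  note a = flip(2-4)
  obtain R where R: "coding h X = insert (a + h) R" "a + h \<notin> R"
    "coding h (flip a X) = insert \<bar>a - h\<bar> R" "\<bar>a - h\<bar> \<notin> R" "finite R"
    using coding_flip[OF flip(1) a] by metis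
  note D = dd_coreD[OF flip(1)]
  have "?G (flip a X) b = ?G X b" if "b \<in> pos (flip a X)" for b
  proof -
    have "b < a" using that a(3)[of b] a(2) by (auto simp: pos_def flip_def)
    then have "{- b<..<b} - flip a X - {0} = {- b<..<b} - X - {0}"
      by (auto simp: flip_def)
    then show ?thesis by simp
  qed
  then have "(\<Prod>b\<in>pos (flip a X). ?G (flip a X) b) = (\<Prod>b\<in>pos (flip a X). ?G X b)"
    by (rule prod.cong[OF refl])
  moreover have "(\<Prod>b\<in>pos X. ?G X b) = ?G X a * (\<Prod>b\<in>pos (flip a X). ?G X b)"
    using pos_flip[OF a(1,2)] prod.insert[OF dd_coreD(5)[OF flip(5)], of a "?G X"] by simp
  ultimately have "(\<Prod>b\<in>pos X. ?G X b) = ?G X a * (\<Prod>b\<in>pos (flip a X). ?G (flip a X) b)"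
    by (simp only:)
  then have "(\<Prod>b\<in>pos X. ?G X b) * coding_prod T w {1..<h}
      = ?G X a * coding_prod T w (insert \<bar>a - h\<bar> R)"
    using flip(6) R(3) by (simp add: mult.assoc)
  also have "\<dots> = ?G X a * (coding_prod T w R * w (a - h) * (\<Prod>s\<in>R. T (a - h - s) * T (a - h + s)))"
    using coding_prod_insert[where T = T and w = w, OF R(5,4) T(2) w(2)] by simp
  also have "?G X a = w (a + h) / w (a - h)
     * (\<Prod>s\<in>R. T (a + h - s) * T (a + h + s) / (T (a - h - s) * T (a - h + s)))"
    using max_element_prod[where T = T, OF flip(1) a T R(1,2,5)] weight[of a] T(1)
    by (simp only: times_divide_eq_left times_divide_eq_right divide_divide_eq_left) (simp add: field_simps)
  also have "\<dots> * (coding_prod T w R * w (a - h) * (\<Prod>s\<in>R. T (a - h - s) * T (a - h + s)))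
    = coding_prod T w R * w (a + h) * (\<Prod>s\<in>R. T (a + h - s) * T (a + h + s))"
    using T(1) w(1) R(5) by (simp add: prod_dividef prod_zero_iff)
  also have "\<dots> = coding_prod T w (insert \<bar>a + h\<bar> R)"
    using coding_prod_insert[where T = T and w = w and x = "a + h", OF R(5) _ T(2) w(2)] R(2) a(2) D(1) by simp
  finally show ?case using R(1) a(2) D(1) by simp
qed

lemma dd_core_size:
  assumes "dd_core h X"
  shows "2 * h * (\<Sum>a\<in>pos X. 2 * a) = (\<Sum>r\<in>coding h X. r\<^sup>2) - (\<Sum>r\<in>{1..<h}. r\<^sup>2)"
  using assms
proof (induction rule: dd_core_induct)
  case (empty X)
  then show ?case using coding_empty dd_coreD(1) dd_core_pos_empty by fastforce
next
  case (flip X a)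
  obtain R where R: "coding h X = insert (a + h) R" "a + h \<notin> R"
    "coding h (flip a X) = insert \<bar>a - h\<bar> R" "\<bar>a - h\<bar> \<notin> R" "finite R"
    using coding_flip[OF flip(1-4)] by metis
  have "(\<Sum>a\<in>pos X. 2 * a) = 2 * a + (\<Sum>a\<in>pos (flip a X). 2 * a)"
    using pos_flip[OF flip(2,3)] dd_coreD(5)[OF flip(5)] by simp
  then have "2 * h * (\<Sum>a\<in>pos X. 2 * a) = 4 * h * a + 2 * h * (\<Sum>a\<in>pos (flip a X). 2 * a)"
    by (simp add: algebra_simps)
  then show ?case
    using flip(6) R by (simp add: power2_eq_square algebra_simps)
qed

lemma card_inversions:
  assumes "dd_core h X"
  shows "int (card (inversions X)) = (\<Sum>a\<in>pos X. 2 * a)"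
proof -
  note D = dd_coreD[OF assms]
  have card: "card ({- a<..<a} - X - {0}) = nat (a - 1)" if "0 < a" for a
  proof -
    have "bij_betw abs ({- a<..<a} - X - {0}) {1..<a}"
    proof (rule bij_betw_imageI)
      show "inj_on abs ({- a<..<a} - X - {0})"
        using D(3) by (auto simp: inj_on_def abs_eq_iff)
      have "y \<in> abs ` ({- a<..<a} - X - {0})" if "y \<in> {1..<a}" for y
        using that D(3)[of y]
        by (cases "y \<in> X") (auto intro: image_eqI[of _ _ "- y"] image_eqI[of _ _ y])
      then show "abs ` ({- a<..<a} - X - {0}) = {1..<a}" by auto
    qed
    then show ?thesis by (simp add: bij_betw_same_card)
  qed
  \<comment> \<open>Counting is the case of a constant factor 2 in the product formula.\<close>
  have "(2::nat) ^ card (inversions X) = (\<Prod>a\<in>pos X. 2 * 2 * (\<Prod>b\<in>{- a<..<a} - X - {0}. 2 * 2))"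
    using inversions_prod[OF assms, of "\<lambda>_ _. 2 :: nat"] by (simp add: case_prod_unfold)
  also have "\<dots> = (\<Prod>a\<in>pos X. 2 ^ nat (2 * a))"
  proof (rule prod.cong[OF refl])
    fix a assume "a \<in> pos X"
    then have a: "0 < a" by (simp add: pos_def)
    then have "nat (2 * a) = 2 + 2 * nat (a - 1)" by simp
    then show "2 * 2 * (\<Prod>b\<in>{- a<..<a} - X - {0}. 2 * 2) = (2::nat) ^ nat (2 * a)"
      by (simp add: card[OF a] power_add power_mult)
  qed
  also have "\<dots> = 2 ^ (\<Sum>a\<in>pos X. nat (2 * a))" by (simp add: power_sum)
  finally have "card (inversions X) = (\<Sum>a\<in>pos X. nat (2 * a))" by simp
  then show ?thesis by (simp add: pos_def)
qed

subsection \<open>From partitions to Maya diagrams\<close>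

lemma part_antimono:
  assumes "is_partition \<mu>" "1 \<le> i" "i \<le> j"
  shows "part \<mu> j \<le> part \<mu> i"
  using assms sorted_wrt_nth_less[of "(\<ge>)" \<mu> "i - 1" "j - 1"]
  by (cases "i = j") (auto simp: part_def is_partition_def)

lemma le_conj_part_iff:
  assumes "is_partition \<mu>" "1 \<le> i" "1 \<le> j"
  shows "i \<le> conj_part \<mu> j \<longleftrightarrow> j \<le> part \<mu> i"
proof -
  let ?A = "{i \<in> {1..length \<mu>}. j \<le> part \<mu> i}"
  have len: "k \<le> length \<mu>" if "1 \<le> k" "j \<le> part \<mu> k" for k
    using that assms(3) by (auto simp: part_def split: if_splits)
  show ?thesis
  proof
    assume "j \<le> part \<mu> i"
    then have "{1..i} \<subseteq> ?A"
      using part_antimono[OF assms(1)] len assms(2) by (auto intro: order_trans)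
    then have "card {1..i} \<le> card ?A" by (intro card_mono) auto
    then show "i \<le> conj_part \<mu> j" by (simp add: conj_part_def)
  next
    assume i: "i \<le> conj_part \<mu> j"
    show "j \<le> part \<mu> i"
    proof (rule ccontr)
      assume "\<not> j \<le> part \<mu> i"
      then have "?A \<subseteq> {1..<i}"
        using part_antimono[OF assms(1,2)]
        by (auto simp: not_le[symmetric] dest: le_trans[of j "part \<mu> _" "part \<mu> i"])
      then have "card ?A \<le> card {1..<i}" by (intro card_mono) auto
      then show False using i assms(2) by (simp add: conj_part_def)
    qed
  qed
qed

definition row_step :: "nat list \<Rightarrow> nat \<Rightarrow> int" where
  "row_step \<mu> i = int (part \<mu> i) - int i"

definition col_step :: "nat list \<Rightarrow> nat \<Rightarrow> int" where
  "col_step \<mu> j = int j - 1 - int (conj_part \<mu> j)"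

definition vertical :: "nat list \<Rightarrow> int set" where
  "vertical \<mu> = {k. word \<mu> k = 0}"

lemma vertical_eq: "vertical \<mu> = row_step \<mu> ` {1..}"
  by (auto simp: vertical_def word_def row_step_def)

lemma row_step_less:
  assumes "is_partition \<mu>" "1 \<le> i" "i < j"
  shows "row_step \<mu> j < row_step \<mu> i"
  using part_antimono[OF assms(1,2), of j] assms(3) by (simp add: row_step_def)

lemma row_step_less_iff:
  assumes "is_partition \<mu>" "1 \<le> i" "1 \<le> j"
  shows "row_step \<mu> j < row_step \<mu> i \<longleftrightarrow> i < j"
  using row_step_less[OF assms(1,2), of j] row_step_less[OF assms(1,3), of i]
  by (cases i j rule: linorder_cases) auto

lemma col_step_less_row_step_iff:
  assumes "is_partition \<mu>" "1 \<le> i" "1 \<le> j"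
  shows "col_step \<mu> j < row_step \<mu> i \<longleftrightarrow> j \<le> part \<mu> i"
    and "col_step \<mu> j \<noteq> row_step \<mu> i"
  using le_conj_part_iff[OF assms] by (auto simp: col_step_def row_step_def)

lemma col_step_less_iff:
  assumes "is_partition \<mu>" "1 \<le> i" "1 \<le> j"
  shows "col_step \<mu> i < col_step \<mu> j \<longleftrightarrow> i < j"
proof -
  have anti: "conj_part \<mu> l \<le> conj_part \<mu> k" if "k \<le> l" for k l
    unfolding conj_part_def using that by (intro card_mono) auto
  show ?thesis
    using anti[of i j] anti[of j i] by (cases "i < j") (auto simp: col_step_def)
qed

lemma not_vertical_eq:
  assumes "is_partition \<mu>"
  shows "- vertical \<mu> = col_step \<mu> ` {1..}"
proof (intro equalityI subsetI)
  fix k assume k: "k \<in> - vertical \<mu>"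
  define A where "A = {i. 1 \<le> i \<and> k < row_step \<mu> i}"
  have "A \<subseteq> {..length \<mu> + nat \<bar>k\<bar>}"
  proof
    fix i assume "i \<in> A"
    then show "i \<in> {..length \<mu> + nat \<bar>k\<bar>}"
      by (cases "i \<le> length \<mu>") (auto simp: A_def row_step_def part_def)
  qed
  then have fin: "finite A" using finite_subset by blast
  define i where "i = (if A = {} then 0 else Max A)"
  have up: "k < row_step \<mu> i" if "1 \<le> i"
    using that Max_in[OF fin] by (auto simp: i_def A_def split: if_splits)
  have "i + 1 \<notin> A"
  proof
    assume "i + 1 \<in> A"
    moreover from this have "i + 1 \<le> Max A" by (rule Max_ge[OF fin])
    ultimately show False by (auto simp: i_def split: if_splits)
  qed
  then have "row_step \<mu> (i + 1) \<le> k" by (simp add: A_def)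
  moreover have "row_step \<mu> (i + 1) \<noteq> k" using k by (auto simp: vertical_eq)
  ultimately have down: "row_step \<mu> (i + 1) < k" by simp
  define j where "j = nat (k + 1 + int i)"
  have j: "int j = k + 1 + int i" "1 \<le> j"
    using down by (auto simp: j_def row_step_def)
  have "\<not> i + 1 \<le> conj_part \<mu> j"
    using le_conj_part_iff[OF assms _ j(2), of "i + 1"] down j by (simp add: row_step_def)
  moreover have "i \<le> conj_part \<mu> j"
    using le_conj_part_iff[OF assms _ j(2), of i] up j by (cases "i = 0") (auto simp: row_step_def)
  ultimately have "conj_part \<mu> j = i" by simp
  then have "k = col_step \<mu> j" using j by (simp add: col_step_def)
  then show "k \<in> col_step \<mu> ` {1..}" using j by blast
next
  fix k assume "k \<in> col_step \<mu> ` {1..}"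
  then show "k \<in> - vertical \<mu>"
    using col_step_less_row_step_iff(2)[OF assms] by (force simp: vertical_eq)
qed

lemma boxes_iff:
  assumes "is_partition \<mu>"
  shows "(i, j) \<in> boxes \<mu> \<longleftrightarrow> 1 \<le> i \<and> 1 \<le> j \<and> j \<le> part \<mu> i"
  by (auto simp: boxes_def part_def)

lemma bij_betw_boxes_inversions:
  assumes "is_partition \<mu>"
  shows "bij_betw (\<lambda>(i, j). (row_step \<mu> i, col_step \<mu> j)) (boxes \<mu>) (inversions (vertical \<mu>))"
proof (rule bij_betw_imageI)
  show "inj_on (\<lambda>(i, j). (row_step \<mu> i, col_step \<mu> j)) (boxes \<mu>)"
  proof (rule inj_onI, clarify)
    fix i j k l
    assume "(i, j) \<in> boxes \<mu>" "(k, l) \<in> boxes \<mu>"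
      and eq: "row_step \<mu> i = row_step \<mu> k" "col_step \<mu> j = col_step \<mu> l"
    then have "1 \<le> i" "1 \<le> j" "1 \<le> k" "1 \<le> l" by (auto simp: boxes_iff[OF assms])
    then show "i = k \<and> j = l"
      using row_step_less_iff[OF assms] col_step_less_iff[OF assms] eq
      by (metis less_irrefl linorder_neqE_nat)
  qed
  have "(a, b) \<in> (\<lambda>(i, j). (row_step \<mu> i, col_step \<mu> j)) ` boxes \<mu>"
    if ab: "a \<in> vertical \<mu>" "b \<notin> vertical \<mu>" "b < a" for a b
  proof -
    obtain i where i: "1 \<le> i" "a = row_step \<mu> i" using ab(1) by (auto simp: vertical_eq)
    have "b \<in> - vertical \<mu>" using ab(2) by simp
    then obtain j where j: "1 \<le> j" "b = col_step \<mu> j"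
      unfolding not_vertical_eq[OF assms] by auto
    then have "(i, j) \<in> boxes \<mu>"
      using i ab(3) col_step_less_row_step_iff(1)[OF assms] by (simp add: boxes_iff[OF assms])
    then show ?thesis using i j by (intro image_eqI[of _ _ "(i, j)"]) auto
  qed
  moreover have "col_step \<mu> j \<notin> vertical \<mu>" if "1 \<le> j" for j
    using that not_vertical_eq[OF assms] by blast
  moreover have "row_step \<mu> i \<in> vertical \<mu>" if "1 \<le> i" for i
    using that by (auto simp: vertical_eq)
  ultimately show "(\<lambda>(i, j). (row_step \<mu> i, col_step \<mu> j)) ` boxes \<mu> = inversions (vertical \<mu>)"
    using col_step_less_row_step_iff(1)[OF assms]
    by (auto simp: inversions_def boxes_iff[OF assms])
qed

lemma hook_eq:
  assumes "is_partition \<mu>" "(i, j) \<in> boxes \<mu>"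
  shows "int (hook \<mu> (i, j)) = row_step \<mu> i - col_step \<mu> j"
proof -
  have "1 \<le> i" "1 \<le> j" "j \<le> part \<mu> i" using assms by (auto simp: boxes_iff)
  moreover from this have "i \<le> conj_part \<mu> j" using le_conj_part_iff assms(1) by blast
  ultimately show ?thesis by (simp add: hook_def row_step_def col_step_def)
qed

lemma boxes_Sigma: "boxes \<mu> = (SIGMA i:{1..length \<mu>}. {1..part \<mu> i})"
  by (auto simp: boxes_def)

lemma finite_boxes: "finite (boxes \<mu>)"
  by (simp add: boxes_Sigma)

lemma sum_list_eq_card_boxes: "sum_list \<mu> = card (boxes \<mu>)"
proof -
  have "card (boxes \<mu>) = (\<Sum>i\<in>{1..length \<mu>}. part \<mu> i)" by (simp add: boxes_Sigma)
  also have "\<dots> = (\<Sum>i<length \<mu>. \<mu> ! i)"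
    by (rule sum.reindex_bij_witness[of _ Suc "\<lambda>i. i - 1"]) (auto simp: part_def)
  finally show ?thesis by (simp add: sum_list_sum_nth atLeast0LessThan)
qed

lemma le_durfee_iff:
  assumes "is_partition \<mu>" "1 \<le> i"
  shows "i \<le> durfee \<mu> \<longleftrightarrow> i \<le> part \<mu> i"
proof -
  let ?A = "{s \<in> {0..length \<mu>}. s \<le> part \<mu> s}"
  have fin: "finite ?A" by simp
  show ?thesis
  proof
    assume i: "i \<le> durfee \<mu>"
    have "Max ?A \<in> ?A" by (rule Max_in[OF fin]) auto
    then have "durfee \<mu> \<le> part \<mu> (durfee \<mu>)" by (simp add: durfee_def)
    then show "i \<le> part \<mu> i" using i part_antimono[OF assms i] by simp
  next
    assume "i \<le> part \<mu> i"
    then have "i \<in> ?A" using assms(2) by (auto simp: part_def split: if_splits)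
    then show "i \<le> durfee \<mu>" unfolding durfee_def by (rule Max_ge[OF fin])
  qed
qed

lemma row_step_nonneg_iff:
  assumes "is_partition \<mu>" "1 \<le> i"
  shows "0 \<le> row_step \<mu> i \<longleftrightarrow> i \<le> durfee \<mu>"
  using le_durfee_iff[OF assms] by (auto simp: row_step_def)

lemma col_step_nonneg_iff:
  assumes "is_partition \<mu>" "1 \<le> j"
  shows "0 \<le> col_step \<mu> j \<longleftrightarrow> durfee \<mu> < j"
  using le_durfee_iff[OF assms] le_conj_part_iff[OF assms(1,2,2)] by (auto simp: col_step_def)

lemma doubled_distinct_col_step:
  assumes "\<mu> \<in> doubled_distinct" "1 \<le> i" "i \<le> durfee \<mu>"
  shows "col_step \<mu> i = - row_step \<mu> i"
  using assms by (auto simp: doubled_distinct_def col_step_def row_step_def)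

lemma doubled_distinct_vertical:
  assumes "\<mu> \<in> doubled_distinct"
  shows "0 \<notin> vertical \<mu>" and "k \<noteq> 0 \<Longrightarrow> - k \<in> vertical \<mu> \<longleftrightarrow> k \<notin> vertical \<mu>"
proof -
  have p: "is_partition \<mu>" using assms by (simp add: doubled_distinct_def)
  have pos: "- k \<notin> vertical \<mu>" if "k \<in> vertical \<mu>" "0 \<le> k" for k
  proof -
    obtain i where i: "1 \<le> i" "k = row_step \<mu> i" using \<open>k \<in> vertical \<mu>\<close> by (auto simp: vertical_eq)
    then have "- k = col_step \<mu> i"
      using that(2) row_step_nonneg_iff[OF p] doubled_distinct_col_step[OF assms] by simp
    then have "- k \<in> - vertical \<mu>" using i(1) not_vertical_eq[OF p] by auto
    then show ?thesis by simp
  qed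
  have neg: "- k \<in> vertical \<mu>" if "k \<notin> vertical \<mu>" "k < 0" for k
  proof -
    have "k \<in> - vertical \<mu>" using that by simp
    then obtain j where j: "1 \<le> j" "k = col_step \<mu> j"
      unfolding not_vertical_eq[OF p] by auto
    then have "j \<le> durfee \<mu>" using that(2) col_step_nonneg_iff[OF p, of j] by simp
    then have "- k = row_step \<mu> j" using j doubled_distinct_col_step[OF assms] by simp
    then show ?thesis using j(1) by (auto simp: vertical_eq)
  qed
  show "0 \<notin> vertical \<mu>" using pos[of 0] by auto
  show "- k \<in> vertical \<mu> \<longleftrightarrow> k \<notin> vertical \<mu>" if "k \<noteq> 0"
    using that pos[of k] pos[of "- k"] neg[of k] neg[of "- k"] by (cases "0 < k") auto
qed

lemma doubled_distinct_eps:
  assumes "\<mu> \<in> doubled_distinct" "(i, j) \<in> boxes \<mu>"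
  shows "eps (i, j) = (if row_step \<mu> i + col_step \<mu> j \<ge> 0 then 1 else - 1)"
proof -
  have p: "is_partition \<mu>" using assms by (simp add: doubled_distinct_def)
  have b: "1 \<le> i" "1 \<le> j" "j \<le> part \<mu> i" using assms(2) p by (auto simp: boxes_iff)
  have "row_step \<mu> i + col_step \<mu> j \<ge> 0 \<longleftrightarrow> i \<le> j"
  proof (cases "j \<le> durfee \<mu>")
    case True
    then show ?thesis
      using doubled_distinct_col_step[OF assms(1) b(2)] row_step_less_iff[OF p b(2,1)] by auto
  next
    case False
    have "i \<le> durfee \<mu>"
    proof (rule ccontr)
      assume i: "\<not> i \<le> durfee \<mu>"
      let ?d = "durfee \<mu> + 1"
      have "?d \<le> part \<mu> i" using b False by simp
      also have "part \<mu> i \<le> part \<mu> ?d" using i by (intro part_antimono[OF p]) auto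
      finally show False using le_durfee_iff[OF p, of ?d] by simp
    qed
    then show ?thesis
      using False row_step_nonneg_iff[OF p b(1)] col_step_nonneg_iff[OF p b(2)] by simp
  qed
  then show ?thesis by (simp add: eps_def)
qed

lemma dd_core_vertical:
  assumes "\<mu> \<in> doubled_distinct_cores g" "int g = 2 * h" "0 < h"
  shows "dd_core h (vertical \<mu>)"
proof -
  have dd: "\<mu> \<in> doubled_distinct" and p: "is_partition \<mu>"
    and core: "\<And>s. s \<in> boxes \<mu> \<Longrightarrow> \<not> g dvd hook \<mu> s"
    using assms(1) by (auto simp: doubled_distinct_cores_def doubled_distinct_def is_core_def)
  have "x - 2 * h \<in> vertical \<mu>" if x: "x \<in> vertical \<mu>" for x
  proof (rule ccontr)
    assume "x - 2 * h \<notin> vertical \<mu>"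
    then have "(x, x - 2 * h) \<in> inversions (vertical \<mu>)"
      using x assms(3) by (simp add: inversions_def)
    then obtain i j where ij: "(i, j) \<in> boxes \<mu>" "row_step \<mu> i = x" "col_step \<mu> j = x - 2 * h"
      unfolding bij_betw_imp_surj_on[OF bij_betw_boxes_inversions[OF p], symmetric] by auto
    then have "int (hook \<mu> (i, j)) = int g" using hook_eq[OF p ij(1)] assms(2) by simp
    then show False using core[OF ij(1)] by simp
  qed
  moreover have "finite {x \<in> vertical \<mu>. 0 < x}"
  proof (rule finite_subset)
    show "{x \<in> vertical \<mu>. 0 < x} \<subseteq> row_step \<mu> ` {1..durfee \<mu>}"
    proof
      fix x assume x: "x \<in> {x \<in> vertical \<mu>. 0 < x}"
      then obtain i where i: "1 \<le> i" "x = row_step \<mu> i" by (auto simp: vertical_eq)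
      then have "i \<le> durfee \<mu>" using x row_step_nonneg_iff[OF p, of i] by simp
      then show "x \<in> row_step \<mu> ` {1..durfee \<mu>}" using i by simp
    qed
  qed simp
  ultimately show ?thesis
    using doubled_distinct_vertical[OF dd] assms(3) by (simp add: dd_core_def)
qed

lemma gaps_eq_beta:
  assumes core: "dd_core h (vertical \<mu>)" and g: "int g = 2 * h"
  shows "gaps h (vertical \<mu>) = beta g \<mu> ` {0..<g}" and "inj_on (beta g \<mu>) {0..<g}"
proof -
  let ?X = "vertical \<mu>"
  note D = dd_coreD[OF core]
  have g0: "0 < int g" using g D(1) by simp
  have down: "x - int n * int g \<in> ?X" if "x \<in> ?X" for x n
    using that
  proof (induction n)
    case (Suc n)
    then show ?case using D(4)[of "x - int n * int g"] g by (simp add: algebra_simps)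
  qed simp
  have beta: "beta g \<mu> i = b" if b: "b \<in> gaps h ?X" and i: "b mod int g = int i" for b i
    unfolding beta_def
  proof (rule Greatest_equality)
    have "b = b div int g * int g + int i" using div_mult_mod_eq[of b "int g"] i by simp
    then show "\<exists>k. b = (k + 1) * int g + int i \<and> word \<mu> (k * int g + int i) = 0"
      using b g by (intro exI[of _ "b div int g - 1"]) (auto simp: gaps_def vertical_def algebra_simps)
    fix y assume "\<exists>k. y = (k + 1) * int g + int i \<and> word \<mu> (k * int g + int i) = 0"
    then obtain k where k: "y = (k + 1) * int g + int i" "k * int g + int i \<in> ?X"
      by (auto simp: vertical_def)
    show "y \<le> b"
    proof (rule ccontr)
      assume "\<not> y \<le> b"
      then have "b div int g * int g < (k + 1) * int g"
        using k(1) \<open>b = b div int g * int g + int i\<close> by linarith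
      then have "b div int g \<le> k" using g0 by (simp add: mult_less_cancel_right)
      then have "(k * int g + int i) - int (nat (k - b div int g)) * int g = b"
        using \<open>b = b div int g * int g + int i\<close> by (simp add: algebra_simps)
      then have "b \<in> ?X" using down[OF k(2), of "nat (k - b div int g)"] by simp
      then show False using b by (simp add: gaps_def)
    qed
  qed
  have ex: "\<exists>b\<in>gaps h ?X. b mod int g = int i" if i: "i < g" for i
  proof -
    have le: "x \<le> Max (insert 0 (pos ?X))" if "x \<in> ?X" for x
    proof (cases "0 < x")
      case True
      then show ?thesis using that D(5) by (intro Max_ge) (auto simp: pos_def)
    next
      case False
      moreover have "0 \<le> Max (insert 0 (pos ?X))" using D(5) by (intro Max_ge) auto
      ultimately show ?thesis by linarith
    qed
    define m where "m = Max (insert 0 (pos ?X))"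
    have m0: "0 \<le> m" using D(5) by (simp add: m_def)
    have ub: "k \<le> m" if "k * int g + int i \<in> ?X" for k
    proof -
      have "k * int g \<le> m" using le[OF that] by (simp add: m_def)
      moreover have "k * 1 \<le> k * int g" if "0 \<le> k"
        by (rule mult_left_mono) (use g0 that in auto)
      ultimately show ?thesis using m0 by linarith
    qed
    have "(- m - 2) * int g + int i \<in> ?X"
    proof (rule ccontr)
      let ?z = "(- m - 2) * int g + int i"
      assume z: "?z \<notin> ?X"
      have "(m + 1) * 1 \<le> (m + 1) * int g" by (rule mult_left_mono) (use g0 m0 in auto)
      then have "m < (m + 1) * int g + (int g - int i)" using i by simp
      also have "\<dots> = - ?z" by (simp add: algebra_simps)
      finally have neg: "m < - ?z" .
      then have "- ?z \<in> ?X" using z D(3)[of ?z] m0 by auto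
      then show False using le[of "- ?z"] neg by (simp add: m_def)
    qed
    moreover define K where "K = {k. k * int g + int i \<in> ?X \<and> - m - 2 \<le> k}"
    ultimately have ne: "K \<noteq> {}" by auto
    have "K \<subseteq> {- m - 2..m}" using ub by (auto simp: K_def)
    then have fin: "finite K" using finite_subset by blast
    define k where "k = Max K"
    have k: "k * int g + int i \<in> ?X" "- m - 2 \<le> k"
      using Max_in[OF fin ne] by (auto simp: K_def k_def)
    have "k + 1 \<notin> K" using Max_ge[OF fin, of "k + 1"] by (auto simp: k_def)
    then have "(k + 1) * int g + int i \<notin> ?X" using k(2) by (simp add: K_def)
    then have "(k + 1) * int g + int i \<in> gaps h ?X"
      using k(1) g by (simp add: gaps_def algebra_simps)
    moreover have "((k + 1) * int g + int i) mod int g = int i" using i by simp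
    ultimately show ?thesis by blast
  qed
  have beta_mem: "beta g \<mu> i \<in> gaps h ?X" "beta g \<mu> i mod int g = int i" if "i < g" for i
    using ex[OF that] beta by auto
  show "gaps h ?X = beta g \<mu> ` {0..<g}"
  proof (intro equalityI subsetI)
    fix b assume b: "b \<in> gaps h ?X"
    have "b mod int g = int (nat (b mod int g))" "nat (b mod int g) < g"
      using g0 by (simp_all add: nat_less_iff)
    then show "b \<in> beta g \<mu> ` {0..<g}" using beta[OF b] by force
  qed (use beta_mem in auto)
  show "inj_on (beta g \<mu>) {0..<g}"
    by (rule inj_onI) (metis atLeastLessThan_iff beta_mem(2) of_nat_eq_iff)
qed

lemma sorted_list_of_set_Un:
  fixes A B :: "'b::linorder set"
  assumes "finite A" "finite B" "\<And>a b. a \<in> A \<Longrightarrow> b \<in> B \<Longrightarrow> a < b"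
  shows "sorted_list_of_set (A \<union> B) = sorted_list_of_set A @ sorted_list_of_set B"
proof -
  let ?L = "sorted_list_of_set A @ sorted_list_of_set B"
  have "sorted ?L" "distinct ?L"
    using assms by (force simp: sorted_append)+
  moreover have "set ?L = A \<union> B" using assms by simp
  ultimately show ?thesis using sorted_list_of_set.idem_if_sorted_distinct[of ?L] by simp
qed

lemma V_coding_eq:
  assumes core: "dd_core h (vertical \<mu>)" and g: "int g = 2 * h" and t: "h = int t + 1"
  shows "card (coding h (vertical \<mu>)) = t"
    and "V_coding g t \<mu> = rev (sorted_list_of_set ((\<lambda>r. h + r) ` coding h (vertical \<mu>)))"
proof -
  let ?R = "coding h (vertical \<mu>)"
  let ?lo = "{0, h} \<union> (\<lambda>r. h - r) ` ?R" and ?hi = "(\<lambda>r. h + r) ` ?R"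
  have fin: "finite ?R" by (rule finite_coding[OF core])
  have R: "0 < r" "r \<noteq> h" if "r \<in> ?R" for r
    using that half_notin_coding[OF core] by (auto simp: coding_def)
  have neg: "- r \<notin> ?R" if "r \<in> ?R" for r using R(1)[of r] R(1)[of "- r"] that by auto
  have h: "0 < h" using dd_coreD(1)[OF core] .
  have gaps: "beta g \<mu> ` {0..<g} = ?lo \<union> ?hi"
    using gaps_eq[OF core] gaps_eq_beta(1)[OF core g] by auto
  have "card (?lo \<union> ?hi) = g"
    unfolding gaps[symmetric] using card_image[OF gaps_eq_beta(2)[OF core g]] by simp
  moreover have "card (?lo \<union> ?hi) = card ?lo + card ?hi"
    using fin h by (intro card_Un_disjoint) (auto dest: R(1) neg)
  moreover have "card ?lo = 2 + card ((\<lambda>r. h - r) ` ?R)"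
    using fin h by (subst card_Un_disjoint) (auto dest: R)
  moreover have "card ((\<lambda>r. h - r) ` ?R) = card ?R" "card ?hi = card ?R"
    by (auto intro!: card_image simp: inj_on_def)
  ultimately show card: "card ?R = t" using g t by linarith
  have "sorted_list_of_set (?lo \<union> ?hi) = sorted_list_of_set ?lo @ sorted_list_of_set ?hi"
    using fin h by (intro sorted_list_of_set_Un) (auto dest!: R(1))
  then show "V_coding g t \<mu> = rev (sorted_list_of_set ?hi)"
    using card \<open>card ?hi = card ?R\<close> unfolding V_coding_def gaps by simp
qed

lemma descending_enumeration:
  fixes r :: "nat \<Rightarrow> int"
  assumes "finite R" "\<And>i. i \<in> {1..card R} \<Longrightarrow>
      r i = rev (sorted_list_of_set ((\<lambda>r. h + r) ` R)) ! (i - 1) - h"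
  shows "bij_betw r {1..card R} R"
    and "1 \<le> i \<Longrightarrow> i < j \<Longrightarrow> j \<le> card R \<Longrightarrow> r j < r i"
proof -
  define L where "L = sorted_list_of_set ((\<lambda>r. h + r) ` R)"
  have "card ((\<lambda>r. h + r) ` R) = card R" by (auto intro!: card_image simp: inj_on_def)
  then have L: "length L = card R" "set L = (\<lambda>r. h + r) ` R" "sorted_wrt (<) L"
    using assms(1) by (auto simp: L_def)
  have r: "r i = L ! (card R - i) - h" if "i \<in> {1..card R}" for i
    using assms(2)[OF that] that L(1) by (auto simp: L_def[symmetric] rev_nth)
  show less: "r j < r i" if "1 \<le> i" "i < j" "j \<le> card R" for i j
    using that r[of i] r[of j] sorted_wrt_nth_less[OF L(3), of "card R - j" "card R - i"] L(1) by simp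
  have "inj_on r {1..card R}"
    by (rule linorder_inj_onI) (use less in fastforce)+
  moreover have "r ` {1..card R} \<subseteq> R"
  proof
    fix x assume "x \<in> r ` {1..card R}"
    then obtain i where i: "i \<in> {1..card R}" "x = r i" by auto
    then have "L ! (card R - i) \<in> set L" using L(1) by (intro nth_mem) auto
    then show "x \<in> R" using r i L(2) by auto
  qed
  ultimately show "bij_betw r {1..card R} R"
    using assms(1) by (simp add: bij_betw_def card_image card_subset_eq)
qed

lemma coding_prod_enum:
  assumes "bij_betw r {1..t::nat} R" "\<And>i j. 1 \<le> i \<Longrightarrow> i < j \<Longrightarrow> j \<le> t \<Longrightarrow> r j < r i"
  shows "coding_prod T w R =
    (\<Prod>i = 1..t. w (r i)) * (\<Prod>i = 1..t. \<Prod>j\<in>{i<..t}. T (r i - r j) * T (r i + r j))"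
proof -
  let ?S = "SIGMA i:{1..t}. {i<..t}"
  have "bij_betw (\<lambda>(i, j). (r i, r j)) ?S (pairs R)"
  proof (rule bij_betw_imageI)
    have inj: "r i = r k \<Longrightarrow> i = k" if "i \<in> {1..t}" "k \<in> {1..t}" for i k
      using that bij_betw_imp_inj_on[OF assms(1)] by (auto dest: inj_onD)
    then show "inj_on (\<lambda>(i, j). (r i, r j)) ?S" by (auto simp: inj_on_def)
    have "(x, y) \<in> (\<lambda>(i, j). (r i, r j)) ` ?S" if xy: "x \<in> R" "y \<in> R" "y < x" for x y
    proof -
      obtain i j where ij: "i \<in> {1..t}" "x = r i" "j \<in> {1..t}" "y = r j"
        using xy bij_betw_imp_surj_on[OF assms(1)] by blast
      then have "i < j" using xy(3) assms(2)[of j i] by (cases i j rule: linorder_cases) auto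
      then show ?thesis using ij by (intro image_eqI[of _ _ "(i, j)"]) auto
    qed
    then show "(\<lambda>(i, j). (r i, r j)) ` ?S = pairs R"
      using assms(2) bij_betw_imp_surj_on[OF assms(1)] by (auto simp: pairs_def)
  qed
  from prod.reindex_bij_betw[OF this, of "\<lambda>(x, y). T (x - y) * T (x + y)", symmetric]
  have "(\<Prod>(x, y)\<in>pairs R. T (x - y) * T (x + y)) = (\<Prod>(i, j)\<in>?S. T (r i - r j) * T (r i + r j))"
    by (simp add: case_prod_unfold)
  also have "\<dots> = (\<Prod>i = 1..t. \<Prod>j\<in>{i<..t}. T (r i - r j) * T (r i + r j))"
    by (rule prod.Sigma[symmetric]) auto
  finally show ?thesis
    using prod.reindex_bij_betw[OF assms(1), of w] by (simp add: coding_prod_def)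
qed

lemma coding_prod_quotient:
  fixes T w :: "int \<Rightarrow> 'a::field" and r :: "nat \<Rightarrow> int"
  assumes "bij_betw r {1..t} R" "\<And>i j. 1 \<le> i \<Longrightarrow> i < j \<Longrightarrow> j \<le> t \<Longrightarrow> r j < r i"
    and h: "h = int t + 1"
  shows "coding_prod T w R / coding_prod T w {1..<h} =
    (\<Prod>i = 1..t. w (r i) / w (int i)) * (\<Prod>i = 1..t. \<Prod>j\<in>{i<..t}.
       T (r i - r j) / T (int j - int i) * (T (r i + r j) / T (2 * h - int i - int j)))"
proof -
  have bij: "bij_betw (\<lambda>i. h - int i) {1..t} {1..<h}"
    by (rule bij_betw_byWitness[of _ "\<lambda>x. nat (h - x)"]) (use h in auto)
  have "(\<Prod>i = 1..t. w (h - int i)) = (\<Prod>i = 1..t. w (int i))"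
    by (rule prod.reindex_bij_witness[of _ "\<lambda>i. t + 1 - i" "\<lambda>i. t + 1 - i"]) (use h in \<open>auto simp: add.commute\<close>)
  moreover have "(h - int i) - (h - int j) = int j - int i"
    "(h - int i) + (h - int j) = 2 * h - int i - int j" for i j by simp_all
  moreover have "coding_prod T w {1..<h} = (\<Prod>i = 1..t. w (h - int i)) *
      (\<Prod>i = 1..t. \<Prod>j\<in>{i<..t}.
        T ((h - int i) - (h - int j)) * T ((h - int i) + (h - int j)))"
    by (rule coding_prod_enum[OF bij]) simp
  ultimately have "coding_prod T w {1..<h} = (\<Prod>i = 1..t. w (int i)) *
      (\<Prod>i = 1..t. \<Prod>j\<in>{i<..t}. T (int j - int i) * T (2 * h - int i - int j))"
    by (simp only:)
  moreover have "coding_prod T w R = (\<Prod>i = 1..t. w (r i)) *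
      (\<Prod>i = 1..t. \<Prod>j\<in>{i<..t}. T (r i - r j) * T (r i + r j))"
    using assms(1,2) by (rule coding_prod_enum)
  ultimately show ?thesis by (simp add: prod_dividef)
qed

lemma boxes_prod:
  fixes f :: "int \<Rightarrow> int \<Rightarrow> 'a::comm_monoid_mult"
  assumes "\<mu> \<in> doubled_distinct"
  shows "(\<Prod>s\<in>boxes \<mu>. f (int (hook \<mu> s)) (eps s))
    = (\<Prod>(a, b)\<in>inversions (vertical \<mu>). f (a - b) (if a + b \<ge> 0 then 1 else - 1))"
proof -
  have p: "is_partition \<mu>" using assms by (simp add: doubled_distinct_def)
  have "(\<Prod>s\<in>boxes \<mu>. f (int (hook \<mu> s)) (eps s)) = (\<Prod>s\<in>boxes \<mu>.
     (\<lambda>(a, b). f (a - b) (if a + b \<ge> 0 then 1 else - 1)) ((\<lambda>(i, j). (row_step \<mu> i, col_step \<mu> j)) s))"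
    using hook_eq[OF p] doubled_distinct_eps[OF assms] by (intro prod.cong) auto
  then show ?thesis
    unfolding prod.reindex_bij_betw[OF bij_betw_boxes_inversions[OF p]] .
qed

lemma boxes_prod_sign:
  fixes \<tau> :: "int \<Rightarrow> 'a::field"
  assumes \<tau>: "\<And>k. \<tau> k \<noteq> 0" and e: "e = 1 \<or> e = - 1"
  shows "(\<Prod>s\<in>boxes \<mu>. \<tau> (int (hook \<mu> s) - e * eps s * int g) / \<tau> (int (hook \<mu> s)))
    = (\<Prod>i = 1..g - 1. (\<tau> (- int i) / \<tau> (int i)) ^ card {s \<in> boxes \<mu>. hook \<mu> s = g - i \<and> eps s = e})
      * (\<Prod>s\<in>boxes \<mu>. \<tau> \<bar>int (hook \<mu> s) - e * eps s * int g\<bar> / \<tau> \<bar>int (hook \<mu> s)\<bar>)"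
proof -
  let ?S = "{s \<in> boxes \<mu>. hook \<mu> s < g \<and> eps s = e}"
  let ?q = "\<lambda>i. \<tau> (- int i) / \<tau> (int i)"
  have hook: "0 < hook \<mu> s" for s by (simp add: hook_def)
  have eps: "eps s = 1 \<or> eps s = - 1" for s by (simp add: eps_def)
  have "(\<Prod>s\<in>boxes \<mu>. \<tau> (int (hook \<mu> s) - e * eps s * int g) / \<tau> (int (hook \<mu> s)))
     = (\<Prod>s\<in>boxes \<mu>. (if hook \<mu> s < g \<and> eps s = e then ?q (g - hook \<mu> s) else 1)
         * (\<tau> \<bar>int (hook \<mu> s) - e * eps s * int g\<bar> / \<tau> \<bar>int (hook \<mu> s)\<bar>))"
  proof (rule prod.cong[OF refl])
    fix s
    show "\<tau> (int (hook \<mu> s) - e * eps s * int g) / \<tau> (int (hook \<mu> s))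
      = (if hook \<mu> s < g \<and> eps s = e then ?q (g - hook \<mu> s) else 1)
         * (\<tau> \<bar>int (hook \<mu> s) - e * eps s * int g\<bar> / \<tau> \<bar>int (hook \<mu> s)\<bar>)"
    proof (cases "hook \<mu> s < g \<and> eps s = e")
      case True
      then have "e * eps s = 1" using e by auto
      then show ?thesis using True \<tau> by (simp add: of_nat_diff)
    next
      case False
      then have "0 \<le> int (hook \<mu> s) - e * eps s * int g" using e eps[of s] by auto
      then show ?thesis using False by (simp only: if_False abs_of_nonneg of_nat_0_le_iff mult_1)
    qed
  qed
  moreover have "(\<Prod>s\<in>boxes \<mu>. if hook \<mu> s < g \<and> eps s = e then ?q (g - hook \<mu> s) else 1)
      = (\<Prod>s\<in>?S. ?q (g - hook \<mu> s))"
    using finite_boxes by (rule prod.inter_filter[symmetric])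
  moreover have "\<dots> = (\<Prod>i = 1..g - 1. \<Prod>s\<in>{s \<in> ?S. g - hook \<mu> s = i}. ?q (g - hook \<mu> s))"
    using finite_boxes hook by (intro prod.group[symmetric]) (auto simp: Suc_le_eq diff_le_mono2)
  moreover have "\<dots> = (\<Prod>i = 1..g - 1. ?q i ^ card {s \<in> boxes \<mu>. hook \<mu> s = g - i \<and> eps s = e})"
  proof (rule prod.cong[OF refl])
    fix i assume "i \<in> {1..g - 1}"
    then have "{s \<in> ?S. g - hook \<mu> s = i} = {s \<in> boxes \<mu>. hook \<mu> s = g - i \<and> eps s = e}"
      by auto
    moreover have "(\<Prod>s\<in>{s \<in> ?S. g - hook \<mu> s = i}. ?q (g - hook \<mu> s))
        = (\<Prod>s\<in>{s \<in> ?S. g - hook \<mu> s = i}. ?q i)"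
      by (rule prod.cong) auto
    ultimately show "(\<Prod>s\<in>{s \<in> ?S. g - hook \<mu> s = i}. ?q (g - hook \<mu> s))
        = ?q i ^ card {s \<in> boxes \<mu>. hook \<mu> s = g - i \<and> eps s = e}"
      by (simp only: prod_constant)
  qed
  ultimately show ?thesis by (simp only: prod.distrib)
qed

lemma boxes_prod_coding:
  fixes T w :: "int \<Rightarrow> 'a::field"
  assumes dd: "\<mu> \<in> doubled_distinct" and core: "dd_core h (vertical \<mu>)" and e: "e = 1 \<or> e = - 1"
    and T: "\<And>x. T x \<noteq> 0" "\<And>x. T (- x) = T x"
    and w: "\<And>x. w x \<noteq> 0" "\<And>x. w (- x) = w x"
    and weight: "\<And>a. w (a + h) / w (a - h) =
      T (a - e * (2 * h)) / T (a - 2 * h) * (T (2 * a - e * (2 * h)) / T (2 * a - 2 * h))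
      * (T (a + h) / T (a - h))"
  shows "(\<Prod>s\<in>boxes \<mu>. T (int (hook \<mu> s) - e * eps s * (2 * h)) / T (int (hook \<mu> s)))
    = coding_prod T w (coding h (vertical \<mu>)) / coding_prod T w {1..<h}"
proof -
  let ?f = "\<lambda>x s. T (x - e * s * (2 * h)) / T x"
  have f: "?f x 1 * ?f x (- 1) = T (x - 2 * h) / T x * (T (x + 2 * h) / T x)" for x
    using e by auto
  have "(\<Prod>s\<in>boxes \<mu>. ?f (int (hook \<mu> s)) (eps s))
    = (\<Prod>a\<in>pos (vertical \<mu>). ?f a 1 * ?f (2 * a) 1 *
            (\<Prod>b\<in>{- a<..<a} - vertical \<mu> - {0}. ?f (a - b) 1 * ?f (a - b) (- 1)))"
    unfolding boxes_prod[OF dd, of ?f] inversions_prod[OF core, of ?f] ..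
  then have "(\<Prod>s\<in>boxes \<mu>. ?f (int (hook \<mu> s)) (eps s)) * coding_prod T w {1..<h}
    = coding_prod T w (coding h (vertical \<mu>))"
    unfolding f using dd_core_prod[OF core T w weight] by simp
  moreover have "coding_prod T w {1..<h} \<noteq> 0"
    using T(1) w(1) by (simp add: coding_prod_def prod_zero_iff finite_pairs case_prod_unfold)
  ultimately show ?thesis by (simp add: field_simps)
qed

lemma sum_squares_int: "6 * (\<Sum>r\<in>{1..<int t + 1}. r\<^sup>2) = int t * (int t + 1) * (2 * int t + 1)"
proof (induction t)
  case (Suc t)
  have "{1..<int (Suc t) + 1} = insert (int t + 1) {1..<int t + 1}" by auto
  then show ?case using Suc by (simp add: power2_eq_square algebra_simps)
qed simp

theorem theorem4p14:
  fixes t g :: nat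
    and \<omega> :: "nat list"
    and v :: "int list"
    and r :: "nat \<Rightarrow> int"
    and \<tau> :: "int \<Rightarrow> 'a::field"
  assumes "t \<ge> 1"
    and "g = 2 * t + 2"
    and "\<omega> \<in> doubled_distinct_cores g"
    and "v = V_coding g t \<omega>"
    and "\<And>i. i \<in> {1..t} \<Longrightarrow> r i = v ! (i - 1) - int (g div 2)"
    and "\<And>k. \<tau> k \<noteq> 0"
  shows "real (sum_list \<omega>) =
           1 / real g * (\<Sum>i = 1..t. (real_of_int (r i))\<^sup>2) - (real g / 2 - 1) * (real g - 1) / 12
    \<and> (\<Prod>s\<in>boxes \<omega>. \<tau> (int (hook \<omega> s) - eps s * int g) / \<tau> (int (hook \<omega> s))) =
           (\<Prod>i = 1..g - 1. (\<tau> (- int i) / \<tau> (int i)) ^ alpha g \<omega> i)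
         * (\<Prod>i = 1..t. \<tau> (r i) / \<tau> (int i))
         * (\<Prod>i = 1..t. \<Prod>j\<in>{i<..t}.
              \<tau> (r i - r j) / \<tau> (int j - int i)
            * (\<tau> (r i + r j) / \<tau> (int g - int i - int j)))
    \<and> (\<Prod>s\<in>boxes \<omega>. \<tau> (int (hook \<omega> s) + eps s * int g) / \<tau> (int (hook \<omega> s))) =
           (\<Prod>i = 1..g - 1. (\<tau> (- int i) / \<tau> (int i)) ^ alpha' g \<omega> i)
         * (\<Prod>i = 1..t.
              \<tau> (2 * r i) / \<tau> (2 * int i)
            * ((\<tau> (r i) * \<tau> (r i + int t + 1) * \<tau> \<bar>r i - int t - 1\<bar>)
               / (\<tau> (int i) * \<tau> (int i + int t + 1) * \<tau> (int t + 1 - int i))))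
         * (\<Prod>i = 1..t. \<Prod>j\<in>{i<..t}.
              \<tau> (r i - r j) / \<tau> (int j - int i)
            * (\<tau> (r i + r j) / \<tau> (int g - int i - int j)))"
proof -
  define h where "h = int t + 1"
  define R where "R = coding h (vertical \<omega>)"
  have h: "0 < h" and g: "int g = 2 * h" and g2: "int (g div 2) = h"
    using assms(2) by (auto simp: h_def)
  have dd: "\<omega> \<in> doubled_distinct" and p: "is_partition \<omega>"
    using assms(3) by (auto simp: doubled_distinct_cores_def doubled_distinct_def)
  have core: "dd_core h (vertical \<omega>)" by (rule dd_core_vertical[OF assms(3) g h])
  have R: "card R = t" "v = rev (sorted_list_of_set ((\<lambda>r. h + r) ` R))"
    using V_coding_eq[OF core g h_def] assms(4) by (auto simp: R_def)
  have fin: "finite R" using finite_coding[OF core] by (simp add: R_def)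
  have r: "i \<in> {1..card R} \<Longrightarrow> r i = rev (sorted_list_of_set ((\<lambda>r. h + r) ` R)) ! (i - 1) - h" for i
    using assms(5) R g2 by simp
  have bij: "bij_betw r {1..t} R"
    using descending_enumeration(1)[OF fin r] R(1) by simp
  have less: "r j < r i" if "1 \<le> i" "i < j" "j \<le> t" for i j
    using descending_enumeration(2)[OF fin r] R(1) that by simp
  have rpos: "0 < r i" if "i \<in> {1..t}" for i
    using bij_betwE[OF bij] that by (auto simp: R_def coding_def)

  have "int g * int (sum_list \<omega>) = (\<Sum>r\<in>R. r\<^sup>2) - (\<Sum>r\<in>{1..<h}. r\<^sup>2)"
    using dd_core_size[OF core] card_inversions[OF core]
      bij_betw_same_card[OF bij_betw_boxes_inversions[OF p]] g
    by (simp add: R_def sum_list_eq_card_boxes)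
  then have "6 * int g * int (sum_list \<omega>)
      = 6 * (\<Sum>i = 1..t. (r i)\<^sup>2) - int t * (int t + 1) * (2 * int t + 1)"
    using sum_squares_int[of t] sum.reindex_bij_betw[OF bij, of "\<lambda>x. x\<^sup>2"] by (simp add: h_def)
  then have "real_of_int (6 * int g * int (sum_list \<omega>))
      = real_of_int (6 * (\<Sum>i = 1..t. (r i)\<^sup>2) - int t * (int t + 1) * (2 * int t + 1))"
    by (simp only:)
  then have size: "6 * real g * real (sum_list \<omega>)
      = 6 * (\<Sum>i = 1..t. (real_of_int (r i))\<^sup>2) - real t * (real t + 1) * (2 * real t + 1)"
    by simp
  have size': "real (sum_list \<omega>) =
      1 / real g * (\<Sum>i = 1..t. (real_of_int (r i))\<^sup>2) - (real g / 2 - 1) * (real g - 1) / 12"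
  proof -
    have "real g \<noteq> 0" "real g = 2 * real t + 2" using assms(2) by auto
    then have "6 * real g * (1 / real g * (\<Sum>i = 1..t. (real_of_int (r i))\<^sup>2) - (real g / 2 - 1) * (real g - 1) / 12)
      = 6 * (\<Sum>i = 1..t. (real_of_int (r i))\<^sup>2) - real t * (real t + 1) * (2 * real t + 1)"
      by (simp add: field_simps)
    with size have "6 * real g * real (sum_list \<omega>) = 6 * real g *
      (1 / real g * (\<Sum>i = 1..t. (real_of_int (r i))\<^sup>2) - (real g / 2 - 1) * (real g - 1) / 12)"
      by simp
    then show ?thesis using \<open>real g \<noteq> 0\<close> by (simp only: mult_cancel_left) simp
  qed

  define T where "T x = \<tau> \<bar>x\<bar>" for x
  have T: "T x \<noteq> 0" "T (- x) = T x" for x using assms(6) by (simp_all add: T_def)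
  have pair: "(\<Prod>i = 1..t. \<Prod>j\<in>{i<..t}.
        T (r i - r j) / T (int j - int i) * (T (r i + r j) / T (2 * h - int i - int j)))
    = (\<Prod>i = 1..t. \<Prod>j\<in>{i<..t}. \<tau> (r i - r j) / \<tau> (int j - int i)
        * (\<tau> (r i + r j) / \<tau> (int g - int i - int j)))"
  proof (intro prod.cong refl)
    fix i j assume ij: "i \<in> {1..t}" "j \<in> {i<..t}"
    then have "r j < r i" "0 < r i" "0 < r j" using less rpos by auto
    then show "T (r i - r j) / T (int j - int i) * (T (r i + r j) / T (2 * h - int i - int j))
      = \<tau> (r i - r j) / \<tau> (int j - int i) * (\<tau> (r i + r j) / \<tau> (int g - int i - int j))"
      using ij g by (simp add: T_def h_def)
  qed

  let ?w = "\<lambda>x. T (2 * x) * (T x * T (x + h) * T (x - h))"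
  have w: "?w x \<noteq> 0" "?w (- x) = ?w x" for x
    using T(1) T(2)[of "2 * x"] T(2)[of x] T(2)[of "- x - h"] T(2)[of "x - h"]
    by (simp_all add: add.commute)
  have "(\<Prod>s\<in>boxes \<omega>. T (int (hook \<omega> s) - 1 * eps s * (2 * h)) / T (int (hook \<omega> s)))
    = coding_prod T T R / coding_prod T T {1..<h}"
    unfolding R_def by (rule boxes_prod_coding[where T = T and w = T, OF dd core _ T T]) (use T in simp_all)
  also have "\<dots> = (\<Prod>i = 1..t. T (r i) / T (int i)) * (\<Prod>i = 1..t. \<Prod>j\<in>{i<..t}.
        T (r i - r j) / T (int j - int i) * (T (r i + r j) / T (2 * h - int i - int j)))"
    by (rule coding_prod_quotient[OF bij less h_def])
  also have "(\<Prod>i = 1..t. T (r i) / T (int i)) = (\<Prod>i = 1..t. \<tau> (r i) / \<tau> (int i))"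
    using rpos by (intro prod.cong refl) (simp add: T_def less_imp_le)
  finally have 1: "(\<Prod>s\<in>boxes \<omega>. \<tau> (int (hook \<omega> s) - eps s * int g) / \<tau> (int (hook \<omega> s))) =
           (\<Prod>i = 1..g - 1. (\<tau> (- int i) / \<tau> (int i)) ^ alpha g \<omega> i)
         * (\<Prod>i = 1..t. \<tau> (r i) / \<tau> (int i))
         * (\<Prod>i = 1..t. \<Prod>j\<in>{i<..t}.
              \<tau> (r i - r j) / \<tau> (int j - int i)
            * (\<tau> (r i + r j) / \<tau> (int g - int i - int j)))"
    using boxes_prod_sign[where \<tau> = \<tau> and e = 1 and \<mu> = \<omega> and g = g, OF assms(6)]
    unfolding pair g alpha_def by (simp add: T_def mult.assoc)

  have "(\<Prod>s\<in>boxes \<omega>. T (int (hook \<omega> s) - (- 1) * eps s * (2 * h)) / T (int (hook \<omega> s)))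
    = coding_prod T ?w R / coding_prod T ?w {1..<h}"
    unfolding R_def
  proof (rule boxes_prod_coding[where T = T and w = ?w, OF dd core _ T w])
    fix a
    have "2 * (a + h) = 2 * a + 2 * h" "2 * (a - h) = 2 * a - 2 * h" "a + h + h = a + 2 * h"
      "a + h - h = a" "a - h + h = a" "a - h - h = a - 2 * h"
      "a - - 1 * (2 * h) = a + 2 * h" "2 * a - - 1 * (2 * h) = 2 * a + 2 * h" by simp_all
    then show "?w (a + h) / ?w (a - h) =
      T (a - - 1 * (2 * h)) / T (a - 2 * h) * (T (2 * a - - 1 * (2 * h)) / T (2 * a - 2 * h))
      * (T (a + h) / T (a - h))"
      using T(1) by (simp only:) (simp add: mult_ac)
  qed simp
  also have "\<dots> = (\<Prod>i = 1..t. ?w (r i) / ?w (int i)) * (\<Prod>i = 1..t. \<Prod>j\<in>{i<..t}.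
        T (r i - r j) / T (int j - int i) * (T (r i + r j) / T (2 * h - int i - int j)))"
    by (rule coding_prod_quotient[OF bij less h_def])
  also have "(\<Prod>i = 1..t. ?w (r i) / ?w (int i)) = (\<Prod>i = 1..t.
              \<tau> (2 * r i) / \<tau> (2 * int i)
            * ((\<tau> (r i) * \<tau> (r i + int t + 1) * \<tau> \<bar>r i - int t - 1\<bar>)
               / (\<tau> (int i) * \<tau> (int i + int t + 1) * \<tau> (int t + 1 - int i))))"
  proof (intro prod.cong refl)
    fix i assume i: "i \<in> {1..t}"
    have "T (int i - h) = \<tau> (int t + 1 - int i)" using i by (simp add: T_def h_def)
    moreover have "T (r i + h) = \<tau> (r i + int t + 1)" "T (r i - h) = \<tau> \<bar>r i - int t - 1\<bar>"
      "T (int i + h) = \<tau> (int i + int t + 1)" "T (2 * r i) = \<tau> (2 * r i)" "T (r i) = \<tau> (r i)"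
      "T (2 * int i) = \<tau> (2 * int i)" "T (int i) = \<tau> (int i)"
      using rpos[OF i] by (simp_all add: T_def h_def algebra_simps)
    ultimately show "?w (r i) / ?w (int i) = \<tau> (2 * r i) / \<tau> (2 * int i)
            * ((\<tau> (r i) * \<tau> (r i + int t + 1) * \<tau> \<bar>r i - int t - 1\<bar>)
               / (\<tau> (int i) * \<tau> (int i + int t + 1) * \<tau> (int t + 1 - int i)))"
      by (simp only: times_divide_times_eq)
  qed
  finally have 2: "(\<Prod>s\<in>boxes \<omega>. \<tau> (int (hook \<omega> s) + eps s * int g) / \<tau> (int (hook \<omega> s))) =
           (\<Prod>i = 1..g - 1. (\<tau> (- int i) / \<tau> (int i)) ^ alpha' g \<omega> i)
         * (\<Prod>i = 1..t.
              \<tau> (2 * r i) / \<tau> (2 * int i)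
            * ((\<tau> (r i) * \<tau> (r i + int t + 1) * \<tau> \<bar>r i - int t - 1\<bar>)
               / (\<tau> (int i) * \<tau> (int i + int t + 1) * \<tau> (int t + 1 - int i))))
         * (\<Prod>i = 1..t. \<Prod>j\<in>{i<..t}.
              \<tau> (r i - r j) / \<tau> (int j - int i)
            * (\<tau> (r i + r j) / \<tau> (int g - int i - int j)))"
    using boxes_prod_sign[where \<tau> = \<tau> and e = "- 1" and \<mu> = \<omega> and g = g, OF assms(6)]
    unfolding pair g alpha'_def by (simp add: T_def mult.assoc)

  show ?thesis using size' 1 2 by (intro conjI)
qed

end
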